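(* Let $x=(x_1,\dots,x_n)$, $f$ a vector of polynomials in $x$, $p$ a polynomial in $x$ with rank $N\geq1$ with respect to $x'=f(x)$, and $Q$ a first-order formula of real arithmetic that characterizes an open subset of $\mathbb{R}^n$. Then the formula $$[x'=f(x)\,\&\,Q]\,p=0 \;\leftrightarrow\; \Big(Q\to \bigwedge_{i=0}^{N-1} L_f^{i}(p)=0\Big)$$ is derivable in the extended dL calculus $\mathcal{C}_1$.
   Context: Lie derivatives: $L_f(p)=\sum_i \frac{\partial p}{\partial x_i} f_i$, $L_f^0(p)=p$, $L_f^{i+1}(p)=L_f(L_f^i(p))$. The rank of $p$ is the smallest $N\geq1$ such that $L_f^N(p)=\sum_{i=0}^{N-1} g_i L_f^i(p)$ holds as a polynomial identity for some polynomials $g_i$ (it exists since $\mathbb{R}[x]$ is Noetherian). Differential dynamic logic (dL): terms are polynomials with rational coefficients in real variables. Formulas are built from $e_1\sim e_2$ ($\sim\in\{=,\geq,>\}$) with $\neg,\wedge,\vee,\to,\leftrightarrow,\forall,\exists$ and modalities $[\alpha]\phi$, $\langle\alpha\rangle\phi$; modality-free formulas are first-order formulas of real arithmetic. Hybrid programs: $x:=e \mid\, ?\phi \mid x'=f(x)\,\&\,Q \mid \alpha\cup\beta \mid \alpha;\beta \mid \alpha^*$, with polynomial $f$ and first-order real arithmetic $Q$. $(\omega,\nu)$ is a transition of $x'=f(x)\,\&\,Q$ iff there are $T\ge 0$ and a solution $\varphi:[0,T]\to$ states of $x'=f(x)$ (other variables constant) with $\varphi(0)=\omega$, $\varphi(T)=\nu$,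 and $Q$ true along $\varphi$; other constructs have standard semantics; $[\alpha]\phi$ holds in $\omega$ iff $\phi$ holds in all $\alpha$-successors, $\langle\alpha\rangle\phi$ iff in some. A sequent $\Gamma\vdash\phi$ means $\bigwedge\Gamma\to\phi$. The base calculus $\mathcal{C}_0$: a classical sequent calculus for first-order logic (cut, weakening, connective rules, real witnesses for $\exists$) in which every valid formula of first-order real arithmetic is an axiom, plus all instances of: $\langle\alpha\rangle\phi\leftrightarrow\neg[\alpha]\neg\phi$; $[x:=e]\phi(x)\leftrightarrow\phi(e)$; $[?\psi]\phi\leftrightarrow(\psi\to\phi)$; $[\alpha\cup\beta]\phi\leftrightarrow[\alpha]\phi\wedge[\beta]\phi$; $[\alpha;\beta]\phi\leftrightarrow[\alpha][\beta]\phi$; $[\alpha^*]\phi\leftrightarrow\phi\wedge[\alpha][\alpha^*]\phi$; (K) $[\alpha](\phi\to\psi)\to([\alpha]\phi\to[\alpha]\psi)$; (I) $[\alpha^*]\phi\leftrightarrow\phi\wedge[\alpha^*](\phi\to[\alpha]\phi)$; (V) $\phi\to[\alpha]\phi$ if no free variable of $\phi$ is changed by $\alpha$; (G) from $\vdash\phi$ infer $\vdash[\alpha]\phi$; (DW) $[x'=f(x)\,\&\,Q]Q$; (DI, with Lie derivatives in place of differential terms) $(Q\to[x'=f(x)\,\&\,Q]L_f(p)\geq0)\to([x'=f(x)\,\&\,Q]p\succcurlyeq0\leftrightarrow(Q\to p\succcurlyeq0))$ for $\succcurlyeq\in\{\geq,>\}$, and the same with $=$; (DMP) $[x'=f(x)\,\&\,Q](Q\to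 R)\to([x'=f(x)\,\&\,R]\phi\to[x'=f(x)\,\&\,Q]\phi)$; (DG) $[x'=f(x)\,\&\,Q]\phi\leftrightarrow\exists y\,[x'=f(x),y'=a(x)y+b(x)\,\&\,Q]\phi$ for a vector $y$ of fresh variables, a matrix $a(x)$ and vector $b(x)$ of polynomials not mentioning $y$; (B$'$) $\langle x'=f(x)\,\&\,Q\rangle\exists y\,\phi\leftrightarrow\exists y\,\langle x'=f(x)\,\&\,Q\rangle\phi$ for $y$ not among $x$. The extended calculus $\mathcal{C}_1$ is $\mathcal{C}_0$ plus all instances of the following axioms, where $y$ is a vector of fresh variables (not occurring in the ODE, its domain, or $p$, $P$) and, for (Cont) and (RI), the ODE contains an equation $x_1'=1$: (Uniq) $\langle x'=f(x)\&Q_1\rangle P_1\wedge\langle x'=f(x)\&Q_2\rangle P_2\to\langle x'=f(x)\&Q_1\wedge Q_2\rangle(P_1\vee P_2)$; (Cont) $x=y\to(p>0\to\langle x'=f(x)\&p>0\rangle x\neq y)$; (Dadj) $\langle x'=f(x)\&Q(x)\rangle x=y\leftrightarrow\langle y'=-f(y)\&Q(y)\rangle y=x$; (RI) $[x'=f(x)]P\leftrightarrow\forall y\,[x'=f(x)\&P\vee x=y](x=y\to P\wedge\langle x'=f(x)\&P\rangle x\neq y)$. *)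

theory Defs
  imports "HOL-Analysis.Analysis" "HOL-Library.Poly_Mapping"
begin

subsection \<open>Polynomials\<close>

text \<open>
  Variables are natural numbers, so that fresh ones are always available. A polynomial is a finitely
  supported map from monomials to coefficients, a monomial being a finitely supported exponent map;
  the ring structure is the library's convolution product. Terms are literally polynomials, so
  polynomial identities hold as equations between terms.
\<close>

type_synonym 'a mpoly = "(nat \<Rightarrow>\<^sub>0 nat) \<Rightarrow>\<^sub>0 'a"

type_synonym trm = "rat mpoly"

type_synonym state = "nat \<Rightarrow> real"

definition Var :: "nat \<Rightarrow> trm" where
  "Var x = Poly_Mapping.single (Poly_Mapping.single x 1) 1"

definition indets :: "'a::zero mpoly \<Rightarrow> nat set" where
  "indets p = (\<Union>m\<in>Poly_Mapping.keys p. Poly_Mapping.keys m)"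

definition teval :: "trm \<Rightarrow> state \<Rightarrow> real" where
  "teval p \<nu> = (\<Sum>m\<in>Poly_Mapping.keys p. of_rat (Poly_Mapping.lookup p m) *
     (\<Prod>x\<in>Poly_Mapping.keys m. \<nu> x ^ Poly_Mapping.lookup m x))"

definition tsubst :: "(nat \<Rightarrow> trm) \<Rightarrow> trm \<Rightarrow> trm" where
  "tsubst \<sigma> p = (\<Sum>m\<in>Poly_Mapping.keys p. Poly_Mapping.single 0 (Poly_Mapping.lookup p m) *
     (\<Prod>x\<in>Poly_Mapping.keys m. \<sigma> x ^ Poly_Mapping.lookup m x))"

definition pdiff :: "nat \<Rightarrow> trm \<Rightarrow> trm" where
  "pdiff x p = (\<Sum>m\<in>Poly_Mapping.keys p.
     Poly_Mapping.single (m - Poly_Mapping.single x 1)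
       (of_nat (Poly_Mapping.lookup m x) * Poly_Mapping.lookup p m))"

type_synonym ode = "(nat \<times> trm) list"

definition lie :: "ode \<Rightarrow> trm \<Rightarrow> trm" where
  "lie ode p = (\<Sum>(x, e)\<leftarrow>ode. pdiff x p * e)"

definition real_mpoly :: "trm \<Rightarrow> real mpoly" where
  "real_mpoly p = Poly_Mapping.map of_rat p"

text \<open>The cofactors range over the polynomial ring over the reals in the variables of the ODE.\<close>

definition lie_dependent :: "ode \<Rightarrow> trm \<Rightarrow> nat \<Rightarrow> bool" where
  "lie_dependent ode p N \<longleftrightarrow> (\<exists>g :: nat \<Rightarrow> real mpoly.
     (\<forall>i<N. indets (g i) \<subseteq> fst ` set ode) \<and>
     real_mpoly ((lie ode ^^ N) p) = (\<Sum>i<N. g i * real_mpoly ((lie ode ^^ i) p)))"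

definition has_rank :: "ode \<Rightarrow> trm \<Rightarrow> nat \<Rightarrow> bool" where
  "has_rank ode p N \<longleftrightarrow> 1 \<le> N \<and> lie_dependent ode p N \<and>
     (\<forall>M. 1 \<le> M \<and> M < N \<longrightarrow> \<not> lie_dependent ode p M)"


subsection \<open>Formulas and hybrid programs\<close>

datatype fml =
    Eq trm trm
  | Geq trm trm
  | Gt trm trm
  | Neg fml
  | And fml fml
  | Or fml fml
  | Imp fml fml
  | Iff fml fml
  | Forall nat fml
  | Exists nat fml
  | Box prog fml
  | Dia prog fml
and prog =
    Assign nat trm
  | Test fml
  | ODE ode fml
  | Choice prog prog
  | Seq prog prog
  | Loop prog

primrec fo :: "fml \<Rightarrow> bool" where
  "fo (Eq a b) = True"
| "fo (Geq a b) = True"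
| "fo (Gt a b) = True"
| "fo (Neg \<phi>) = fo \<phi>"
| "fo (And \<phi> \<psi>) = (fo \<phi> \<and> fo \<psi>)"
| "fo (Or \<phi> \<psi>) = (fo \<phi> \<and> fo \<psi>)"
| "fo (Imp \<phi> \<psi>) = (fo \<phi> \<and> fo \<psi>)"
| "fo (Iff \<phi> \<psi>) = (fo \<phi> \<and> fo \<psi>)"
| "fo (Forall x \<phi>) = fo \<phi>"
| "fo (Exists x \<phi>) = fo \<phi>"
| "fo (Box \<alpha> \<phi>) = False"
| "fo (Dia \<alpha> \<phi>) = False"

text \<open>
  Well-formedness: the left-hand sides of an ODE are distinct variables and its domain is a
  first-order formula.
\<close>

primrec wf_fml :: "fml \<Rightarrow> bool" and wf_prog :: "prog \<Rightarrow> bool" where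
  "wf_fml (Eq a b) = True"
| "wf_fml (Geq a b) = True"
| "wf_fml (Gt a b) = True"
| "wf_fml (Neg \<phi>) = wf_fml \<phi>"
| "wf_fml (And \<phi> \<psi>) = (wf_fml \<phi> \<and> wf_fml \<psi>)"
| "wf_fml (Or \<phi> \<psi>) = (wf_fml \<phi> \<and> wf_fml \<psi>)"
| "wf_fml (Imp \<phi> \<psi>) = (wf_fml \<phi> \<and> wf_fml \<psi>)"
| "wf_fml (Iff \<phi> \<psi>) = (wf_fml \<phi> \<and> wf_fml \<psi>)"
| "wf_fml (Forall x \<phi>) = wf_fml \<phi>"
| "wf_fml (Exists x \<phi>) = wf_fml \<phi>"
| "wf_fml (Box \<alpha> \<phi>) = (wf_prog \<alpha> \<and> wf_fml \<phi>)"
| "wf_fml (Dia \<alpha> \<phi>) = (wf_prog \<alpha> \<and> wf_fml \<phi>)"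
| "wf_prog (Assign x e) = True"
| "wf_prog (Test \<phi>) = wf_fml \<phi>"
| "wf_prog (ODE ode Q) = (distinct (map fst ode) \<and> fo Q)"
| "wf_prog (Choice \<alpha> \<beta>) = (wf_prog \<alpha> \<and> wf_prog \<beta>)"
| "wf_prog (Seq \<alpha> \<beta>) = (wf_prog \<alpha> \<and> wf_prog \<beta>)"
| "wf_prog (Loop \<alpha>) = wf_prog \<alpha>"

primrec sat :: "fml \<Rightarrow> state \<Rightarrow> bool" and transition :: "prog \<Rightarrow> state \<Rightarrow> state \<Rightarrow> bool" where
  "sat (Eq a b) = (\<lambda>\<nu>. teval a \<nu> = teval b \<nu>)"
| "sat (Geq a b) = (\<lambda>\<nu>. teval a \<nu> \<ge> teval b \<nu>)"
| "sat (Gt a b) = (\<lambda>\<nu>. teval a \<nu> > teval b \<nu>)"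
| "sat (Neg \<phi>) = (\<lambda>\<nu>. \<not> sat \<phi> \<nu>)"
| "sat (And \<phi> \<psi>) = (\<lambda>\<nu>. sat \<phi> \<nu> \<and> sat \<psi> \<nu>)"
| "sat (Or \<phi> \<psi>) = (\<lambda>\<nu>. sat \<phi> \<nu> \<or> sat \<psi> \<nu>)"
| "sat (Imp \<phi> \<psi>) = (\<lambda>\<nu>. sat \<phi> \<nu> \<longrightarrow> sat \<psi> \<nu>)"
| "sat (Iff \<phi> \<psi>) = (\<lambda>\<nu>. sat \<phi> \<nu> \<longleftrightarrow> sat \<psi> \<nu>)"
| "sat (Forall x \<phi>) = (\<lambda>\<nu>. \<forall>r. sat \<phi> (\<nu>(x := r)))"
| "sat (Exists x \<phi>) = (\<lambda>\<nu>. \<exists>r. sat \<phi> (\<nu>(x := r)))"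
| "sat (Box \<alpha> \<phi>) = (\<lambda>\<nu>. \<forall>\<mu>. transition \<alpha> \<nu> \<mu> \<longrightarrow> sat \<phi> \<mu>)"
| "sat (Dia \<alpha> \<phi>) = (\<lambda>\<nu>. \<exists>\<mu>. transition \<alpha> \<nu> \<mu> \<and> sat \<phi> \<mu>)"
| "transition (Assign x e) = (\<lambda>\<nu> \<mu>. \<mu> = \<nu>(x := teval e \<nu>))"
| "transition (Test \<phi>) = (\<lambda>\<nu> \<mu>. \<mu> = \<nu> \<and> sat \<phi> \<nu>)"
| "transition (ODE ode Q) = (\<lambda>\<nu> \<mu>. \<exists>T\<ge>0. \<exists>\<Phi> :: real \<Rightarrow> state. \<Phi> 0 = \<nu> \<and> \<Phi> T = \<mu> \<and>
     (\<forall>t\<in>{0..T}.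
        (\<forall>(x, e)\<in>set ode. ((\<lambda>s. \<Phi> s x) has_real_derivative teval e (\<Phi> t)) (at t within {0..T})) \<and>
        (\<forall>y. y \<notin> fst ` set ode \<longrightarrow> \<Phi> t y = \<nu> y) \<and>
        sat Q (\<Phi> t)))"
| "transition (Choice \<alpha> \<beta>) = (\<lambda>\<nu> \<mu>. transition \<alpha> \<nu> \<mu> \<or> transition \<beta> \<nu> \<mu>)"
| "transition (Seq \<alpha> \<beta>) = (\<lambda>\<nu> \<mu>. \<exists>\<kappa>. transition \<alpha> \<nu> \<kappa> \<and> transition \<beta> \<kappa> \<mu>)"
| "transition (Loop \<alpha>) = (transition \<alpha>)\<^sup>*\<^sup>*"


subsection \<open>Variables and substitution\<close>

definition ode_vars :: "ode \<Rightarrow> nat set" where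
  "ode_vars ode = (\<Union>(x, e)\<in>set ode. insert x (indets e))"

text \<open>All occurring variables, free or bound.\<close>

primrec vars :: "fml \<Rightarrow> nat set" and vars_prog :: "prog \<Rightarrow> nat set" where
  "vars (Eq a b) = indets a \<union> indets b"
| "vars (Geq a b) = indets a \<union> indets b"
| "vars (Gt a b) = indets a \<union> indets b"
| "vars (Neg \<phi>) = vars \<phi>"
| "vars (And \<phi> \<psi>) = vars \<phi> \<union> vars \<psi>"
| "vars (Or \<phi> \<psi>) = vars \<phi> \<union> vars \<psi>"
| "vars (Imp \<phi> \<psi>) = vars \<phi> \<union> vars \<psi>"
| "vars (Iff \<phi> \<psi>) = vars \<phi> \<union> vars \<psi>"
| "vars (Forall x \<phi>) = insert x (vars \<phi>)"
| "vars (Exists x \<phi>) = insert x (vars \<phi>)"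
| "vars (Box \<alpha> \<phi>) = vars_prog \<alpha> \<union> vars \<phi>"
| "vars (Dia \<alpha> \<phi>) = vars_prog \<alpha> \<union> vars \<phi>"
| "vars_prog (Assign x e) = insert x (indets e)"
| "vars_prog (Test \<phi>) = vars \<phi>"
| "vars_prog (ODE ode Q) = ode_vars ode \<union> vars Q"
| "vars_prog (Choice \<alpha> \<beta>) = vars_prog \<alpha> \<union> vars_prog \<beta>"
| "vars_prog (Seq \<alpha> \<beta>) = vars_prog \<alpha> \<union> vars_prog \<beta>"
| "vars_prog (Loop \<alpha>) = vars_prog \<alpha>"

text \<open>Variables that a program may change, and variables that it writes on every run.\<close>

primrec BV :: "prog \<Rightarrow> nat set" where
  "BV (Assign x e) = {x}"
| "BV (Test \<phi>) = {}"
| "BV (ODE ode Q) = fst ` set ode"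
| "BV (Choice \<alpha> \<beta>) = BV \<alpha> \<union> BV \<beta>"
| "BV (Seq \<alpha> \<beta>) = BV \<alpha> \<union> BV \<beta>"
| "BV (Loop \<alpha>) = BV \<alpha>"

primrec MBV :: "prog \<Rightarrow> nat set" where
  "MBV (Assign x e) = {x}"
| "MBV (Test \<phi>) = {}"
| "MBV (ODE ode Q) = fst ` set ode"
| "MBV (Choice \<alpha> \<beta>) = MBV \<alpha> \<inter> MBV \<beta>"
| "MBV (Seq \<alpha> \<beta>) = MBV \<alpha> \<union> MBV \<beta>"
| "MBV (Loop \<alpha>) = {}"

text \<open>The variables evolving along an ODE are free in it: their initial values matter.\<close>

primrec FV :: "fml \<Rightarrow> nat set" and FV_prog :: "prog \<Rightarrow> nat set" where
  "FV (Eq a b) = indets a \<union> indets b"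
| "FV (Geq a b) = indets a \<union> indets b"
| "FV (Gt a b) = indets a \<union> indets b"
| "FV (Neg \<phi>) = FV \<phi>"
| "FV (And \<phi> \<psi>) = FV \<phi> \<union> FV \<psi>"
| "FV (Or \<phi> \<psi>) = FV \<phi> \<union> FV \<psi>"
| "FV (Imp \<phi> \<psi>) = FV \<phi> \<union> FV \<psi>"
| "FV (Iff \<phi> \<psi>) = FV \<phi> \<union> FV \<psi>"
| "FV (Forall x \<phi>) = FV \<phi> - {x}"
| "FV (Exists x \<phi>) = FV \<phi> - {x}"
| "FV (Box \<alpha> \<phi>) = FV_prog \<alpha> \<union> (FV \<phi> - MBV \<alpha>)"
| "FV (Dia \<alpha> \<phi>) = FV_prog \<alpha> \<union> (FV \<phi> - MBV \<alpha>)"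
| "FV_prog (Assign x e) = indets e"
| "FV_prog (Test \<phi>) = FV \<phi>"
| "FV_prog (ODE ode Q) = ode_vars ode \<union> FV Q"
| "FV_prog (Choice \<alpha> \<beta>) = FV_prog \<alpha> \<union> FV_prog \<beta>"
| "FV_prog (Seq \<alpha> \<beta>) = FV_prog \<alpha> \<union> (FV_prog \<beta> - MBV \<alpha>)"
| "FV_prog (Loop \<alpha>) = FV_prog \<alpha>"

primrec fsubst :: "fml \<Rightarrow> (nat \<Rightarrow> trm) \<Rightarrow> fml" and psubst :: "prog \<Rightarrow> (nat \<Rightarrow> trm) \<Rightarrow> prog" where
  "fsubst (Eq a b) = (\<lambda>\<sigma>. Eq (tsubst \<sigma> a) (tsubst \<sigma> b))"
| "fsubst (Geq a b) = (\<lambda>\<sigma>. Geq (tsubst \<sigma> a) (tsubst \<sigma> b))"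
| "fsubst (Gt a b) = (\<lambda>\<sigma>. Gt (tsubst \<sigma> a) (tsubst \<sigma> b))"
| "fsubst (Neg \<phi>) = (\<lambda>\<sigma>. Neg (fsubst \<phi> \<sigma>))"
| "fsubst (And \<phi> \<psi>) = (\<lambda>\<sigma>. And (fsubst \<phi> \<sigma>) (fsubst \<psi> \<sigma>))"
| "fsubst (Or \<phi> \<psi>) = (\<lambda>\<sigma>. Or (fsubst \<phi> \<sigma>) (fsubst \<psi> \<sigma>))"
| "fsubst (Imp \<phi> \<psi>) = (\<lambda>\<sigma>. Imp (fsubst \<phi> \<sigma>) (fsubst \<psi> \<sigma>))"
| "fsubst (Iff \<phi> \<psi>) = (\<lambda>\<sigma>. Iff (fsubst \<phi> \<sigma>) (fsubst \<psi> \<sigma>))"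
| "fsubst (Forall x \<phi>) = (\<lambda>\<sigma>. Forall x (fsubst \<phi> (\<sigma>(x := Var x))))"
| "fsubst (Exists x \<phi>) = (\<lambda>\<sigma>. Exists x (fsubst \<phi> (\<sigma>(x := Var x))))"
| "fsubst (Box \<alpha> \<phi>) = (\<lambda>\<sigma>. Box (psubst \<alpha> \<sigma>) (fsubst \<phi> \<sigma>))"
| "fsubst (Dia \<alpha> \<phi>) = (\<lambda>\<sigma>. Dia (psubst \<alpha> \<sigma>) (fsubst \<phi> \<sigma>))"
| "psubst (Assign x e) = (\<lambda>\<sigma>. Assign x (tsubst \<sigma> e))"
| "psubst (Test \<phi>) = (\<lambda>\<sigma>. Test (fsubst \<phi> \<sigma>))"
| "psubst (ODE ode Q) = (\<lambda>\<sigma>. ODE (map (\<lambda>(x, e). (x, tsubst \<sigma> e)) ode) (fsubst Q \<sigma>))"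
| "psubst (Choice \<alpha> \<beta>) = (\<lambda>\<sigma>. Choice (psubst \<alpha> \<sigma>) (psubst \<beta> \<sigma>))"
| "psubst (Seq \<alpha> \<beta>) = (\<lambda>\<sigma>. Seq (psubst \<alpha> \<sigma>) (psubst \<beta> \<sigma>))"
| "psubst (Loop \<alpha>) = (\<lambda>\<sigma>. Loop (psubst \<alpha> \<sigma>))"

text \<open>
  Substituting \<open>\<sigma>\<close> for the variables \<open>V\<close> does not clash with a program that changes the
  variables \<open>B\<close>: no replaced variable and no variable of a replacement is in \<open>B\<close>.
\<close>

definition no_clash :: "(nat \<Rightarrow> trm) \<Rightarrow> nat set \<Rightarrow> nat set \<Rightarrow> bool" where
  "no_clash \<sigma> V B \<longleftrightarrow> (\<forall>v\<in>V. \<sigma> v \<noteq> Var v \<longrightarrow> insert v (indets (\<sigma> v)) \<inter> B = {})"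

primrec admissible :: "fml \<Rightarrow> (nat \<Rightarrow> trm) \<Rightarrow> bool"
  and admissible_prog :: "prog \<Rightarrow> (nat \<Rightarrow> trm) \<Rightarrow> bool" where
  "admissible (Eq a b) = (\<lambda>\<sigma>. True)"
| "admissible (Geq a b) = (\<lambda>\<sigma>. True)"
| "admissible (Gt a b) = (\<lambda>\<sigma>. True)"
| "admissible (Neg \<phi>) = (\<lambda>\<sigma>. admissible \<phi> \<sigma>)"
| "admissible (And \<phi> \<psi>) = (\<lambda>\<sigma>. admissible \<phi> \<sigma> \<and> admissible \<psi> \<sigma>)"
| "admissible (Or \<phi> \<psi>) = (\<lambda>\<sigma>. admissible \<phi> \<sigma> \<and> admissible \<psi> \<sigma>)"
| "admissible (Imp \<phi> \<psi>) = (\<lambda>\<sigma>. admissible \<phi> \<sigma> \<and> admissible \<psi> \<sigma>)"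
| "admissible (Iff \<phi> \<psi>) = (\<lambda>\<sigma>. admissible \<phi> \<sigma> \<and> admissible \<psi> \<sigma>)"
| "admissible (Forall x \<phi>) = (\<lambda>\<sigma>. no_clash \<sigma> (FV \<phi> - {x}) {x} \<and> admissible \<phi> (\<sigma>(x := Var x)))"
| "admissible (Exists x \<phi>) = (\<lambda>\<sigma>. no_clash \<sigma> (FV \<phi> - {x}) {x} \<and> admissible \<phi> (\<sigma>(x := Var x)))"
| "admissible (Box \<alpha> \<phi>) = (\<lambda>\<sigma>. no_clash \<sigma> (FV_prog \<alpha> \<union> FV \<phi>) (BV \<alpha>) \<and>
     admissible_prog \<alpha> \<sigma> \<and> admissible \<phi> \<sigma>)"
| "admissible (Dia \<alpha> \<phi>) = (\<lambda>\<sigma>. no_clash \<sigma> (FV_prog \<alpha> \<union> FV \<phi>) (BV \<alpha>) \<and>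
     admissible_prog \<alpha> \<sigma> \<and> admissible \<phi> \<sigma>)"
| "admissible_prog (Assign x e) = (\<lambda>\<sigma>. True)"
| "admissible_prog (Test \<phi>) = (\<lambda>\<sigma>. admissible \<phi> \<sigma>)"
| "admissible_prog (ODE ode Q) = (\<lambda>\<sigma>. no_clash \<sigma> (ode_vars ode \<union> FV Q) (fst ` set ode) \<and>
     admissible Q \<sigma>)"
| "admissible_prog (Choice \<alpha> \<beta>) = (\<lambda>\<sigma>. admissible_prog \<alpha> \<sigma> \<and> admissible_prog \<beta> \<sigma>)"
| "admissible_prog (Seq \<alpha> \<beta>) = (\<lambda>\<sigma>. no_clash \<sigma> (FV_prog \<alpha> \<union> FV_prog \<beta>) (BV \<alpha>) \<and>
     admissible_prog \<alpha> \<sigma> \<and> admissible_prog \<beta> \<sigma>)"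
| "admissible_prog (Loop \<alpha>) = (\<lambda>\<sigma>. no_clash \<sigma> (FV_prog \<alpha>) (BV \<alpha>) \<and> admissible_prog \<alpha> \<sigma>)"

text \<open>
  \<open>instance_of x e \<phi> \<psi>\<close>: the formula \<open>\<psi>\<close> is \<open>\<phi>(e)\<close>, the capture-free replacement of \<open>x\<close> by \<open>e\<close>
  in \<open>\<phi>(x)\<close>. Replacing \<open>x\<close> by itself is always allowed, also where a program changes \<open>x\<close>.
\<close>

definition instance_of :: "nat \<Rightarrow> trm \<Rightarrow> fml \<Rightarrow> fml \<Rightarrow> bool" where
  "instance_of x e \<phi> \<psi> \<longleftrightarrow> (e = Var x \<and> \<psi> = \<phi>) \<or>
     (admissible \<phi> (Var(x := e)) \<and> \<psi> = fsubst \<phi> (Var(x := e)))"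

definition rename :: "nat list \<Rightarrow> nat list \<Rightarrow> nat \<Rightarrow> trm" where
  "rename xs ys v = (case map_of (zip xs ys) v of None \<Rightarrow> Var v | Some y \<Rightarrow> Var y)"


subsection \<open>The calculi\<close>

definition TT :: fml where
  "TT = Eq 0 0"

definition FF :: fml where
  "FF = Neg TT"

fun Conj :: "fml list \<Rightarrow> fml" where
  "Conj [] = TT"
| "Conj [\<phi>] = \<phi>"
| "Conj (\<phi> # \<psi> # \<phi>s) = And \<phi> (Conj (\<psi> # \<phi>s))"

definition EqV :: "nat list \<Rightarrow> nat list \<Rightarrow> fml" where
  "EqV xs ys = Conj (map2 (\<lambda>x y. Eq (Var x) (Var y)) xs ys)"

text \<open>The linear equations \<open>y' = a y + b\<close> for a vector \<open>y\<close>, a matrix \<open>a\<close> and a vector \<open>b\<close>.\<close>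

definition ghosts :: "nat list \<Rightarrow> (nat \<Rightarrow> nat \<Rightarrow> trm) \<Rightarrow> (nat \<Rightarrow> trm) \<Rightarrow> ode" where
  "ghosts ys a b = map (\<lambda>i. (ys ! i, (\<Sum>j<length ys. a i j * Var (ys ! j)) + b i)) [0..<length ys]"

inductive axiom0 :: "fml \<Rightarrow> bool" where
  Arith: "fo \<phi> \<Longrightarrow> \<forall>\<nu>. sat \<phi> \<nu> \<Longrightarrow> axiom0 \<phi>"
| Diamond: "axiom0 (Iff (Dia \<alpha> \<phi>) (Neg (Box \<alpha> (Neg \<phi>))))"
| Assignb: "instance_of x e \<phi> \<psi> \<Longrightarrow> axiom0 (Iff (Box (Assign x e) \<phi>) \<psi>)"
| Testb: "axiom0 (Iff (Box (Test \<psi>) \<phi>) (Imp \<psi> \<phi>))"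
| Choiceb: "axiom0 (Iff (Box (Choice \<alpha> \<beta>) \<phi>) (And (Box \<alpha> \<phi>) (Box \<beta> \<phi>)))"
| Seqb: "axiom0 (Iff (Box (Seq \<alpha> \<beta>) \<phi>) (Box \<alpha> (Box \<beta> \<phi>)))"
| Loopb: "axiom0 (Iff (Box (Loop \<alpha>) \<phi>) (And \<phi> (Box \<alpha> (Box (Loop \<alpha>) \<phi>))))"
| K: "axiom0 (Imp (Box \<alpha> (Imp \<phi> \<psi>)) (Imp (Box \<alpha> \<phi>) (Box \<alpha> \<psi>)))"
| I: "axiom0 (Iff (Box (Loop \<alpha>) \<phi>) (And \<phi> (Box (Loop \<alpha>) (Imp \<phi> (Box \<alpha> \<phi>)))))"
| V: "FV \<phi> \<inter> BV \<alpha> = {} \<Longrightarrow> axiom0 (Imp \<phi> (Box \<alpha> \<phi>))"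
| DW: "axiom0 (Box (ODE ode Q) Q)"
| DI_Geq: "axiom0 (Imp (Imp Q (Box (ODE ode Q) (Geq (lie ode p) 0)))
     (Iff (Box (ODE ode Q) (Geq p 0)) (Imp Q (Geq p 0))))"
| DI_Gt: "axiom0 (Imp (Imp Q (Box (ODE ode Q) (Geq (lie ode p) 0)))
     (Iff (Box (ODE ode Q) (Gt p 0)) (Imp Q (Gt p 0))))"
| DI_Eq: "axiom0 (Imp (Imp Q (Box (ODE ode Q) (Eq (lie ode p) 0)))
     (Iff (Box (ODE ode Q) (Eq p 0)) (Imp Q (Eq p 0))))"
| DMP: "axiom0 (Imp (Box (ODE ode Q) (Imp Q R)) (Imp (Box (ODE ode R) \<phi>) (Box (ODE ode Q) \<phi>)))"
| DG: "distinct ys \<Longrightarrow> set ys \<inter> (ode_vars ode \<union> vars Q \<union> vars \<phi>) = {} \<Longrightarrow>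
     (\<forall>i<length ys. \<forall>j<length ys. indets (a i j) \<inter> set ys = {}) \<Longrightarrow>
     (\<forall>i<length ys. indets (b i) \<inter> set ys = {}) \<Longrightarrow>
     axiom0 (Iff (Box (ODE ode Q) \<phi>) (foldr Exists ys (Box (ODE (ode @ ghosts ys a b) Q) \<phi>)))"
| B': "y \<notin> ode_vars ode \<union> vars Q \<Longrightarrow>
     axiom0 (Iff (Dia (ODE ode Q) (Exists y \<phi>)) (Exists y (Dia (ODE ode Q) \<phi>)))"

inductive axiom1 :: "fml \<Rightarrow> bool" where
  Base: "axiom0 \<phi> \<Longrightarrow> axiom1 \<phi>"
| Uniq: "axiom1 (Imp (And (Dia (ODE ode Q\<^sub>1) P\<^sub>1) (Dia (ODE ode Q\<^sub>2) P\<^sub>2))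
     (Dia (ODE ode (And Q\<^sub>1 Q\<^sub>2)) (Or P\<^sub>1 P\<^sub>2)))"
| Cont: "xs = map fst ode \<Longrightarrow> 1 \<in> snd ` set ode \<Longrightarrow>
     length ys = length xs \<Longrightarrow> distinct ys \<Longrightarrow> set ys \<inter> (ode_vars ode \<union> indets p) = {} \<Longrightarrow>
     axiom1 (Imp (EqV xs ys) (Imp (Gt p 0) (Dia (ODE ode (Gt p 0)) (Neg (EqV xs ys)))))"
| Dadj: "xs = map fst ode \<Longrightarrow>
     length ys = length xs \<Longrightarrow> distinct ys \<Longrightarrow> set ys \<inter> (ode_vars ode \<union> vars Q) = {} \<Longrightarrow>
     axiom1 (Iff (Dia (ODE ode Q) (EqV xs ys))
       (Dia (ODE (zip ys (map (\<lambda>e. - tsubst (rename xs ys) e) (map snd ode)))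
         (fsubst Q (rename xs ys))) (EqV ys xs)))"
| RI: "xs = map fst ode \<Longrightarrow> 1 \<in> snd ` set ode \<Longrightarrow>
     length ys = length xs \<Longrightarrow> distinct ys \<Longrightarrow> set ys \<inter> (ode_vars ode \<union> vars P) = {} \<Longrightarrow>
     axiom1 (Iff (Box (ODE ode TT) P)
       (foldr Forall ys (Box (ODE ode (Or P (EqV xs ys)))
         (Imp (EqV xs ys) (And P (Dia (ODE ode P) (Neg (EqV xs ys))))))))"

text \<open>
  Sequents with a single succedent over a set of axioms. The antecedent is a list read as a finite
  set: weakening subsumes exchange and contraction. \<open>Contra\<close> makes the calculus classical.
\<close>

inductive derivable :: "(fml \<Rightarrow> bool) \<Rightarrow> fml list \<Rightarrow> fml \<Rightarrow> bool" for Ax :: "fml \<Rightarrow> bool" where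
  Axiom: "Ax \<phi> \<Longrightarrow> wf_fml \<phi> \<Longrightarrow> derivable Ax [] \<phi>"
| G: "derivable Ax [] \<phi> \<Longrightarrow> wf_prog \<alpha> \<Longrightarrow> derivable Ax [] (Box \<alpha> \<phi>)"
| Id: "wf_fml \<phi> \<Longrightarrow> derivable Ax [\<phi>] \<phi>"
| Weaken: "derivable Ax \<Gamma> \<phi> \<Longrightarrow> set \<Gamma> \<subseteq> set \<Delta> \<Longrightarrow> (\<forall>\<psi>\<in>set \<Delta>. wf_fml \<psi>) \<Longrightarrow> derivable Ax \<Delta> \<phi>"
| Cut: "derivable Ax \<Gamma> \<phi> \<Longrightarrow> derivable Ax (\<phi> # \<Gamma>) \<psi> \<Longrightarrow> derivable Ax \<Gamma> \<psi>"
| Contra: "derivable Ax (Neg \<phi> # \<Gamma>) FF \<Longrightarrow> derivable Ax \<Gamma> \<phi>"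
| NegR: "derivable Ax (\<phi> # \<Gamma>) FF \<Longrightarrow> derivable Ax \<Gamma> (Neg \<phi>)"
| NegL: "derivable Ax \<Gamma> \<phi> \<Longrightarrow> wf_fml \<psi> \<Longrightarrow> derivable Ax (Neg \<phi> # \<Gamma>) \<psi>"
| AndR: "derivable Ax \<Gamma> \<phi> \<Longrightarrow> derivable Ax \<Gamma> \<psi> \<Longrightarrow> derivable Ax \<Gamma> (And \<phi> \<psi>)"
| AndL: "derivable Ax (\<phi> # \<psi> # \<Gamma>) \<theta> \<Longrightarrow> derivable Ax (And \<phi> \<psi> # \<Gamma>) \<theta>"
| OrR1: "derivable Ax \<Gamma> \<phi> \<Longrightarrow> wf_fml \<psi> \<Longrightarrow> derivable Ax \<Gamma> (Or \<phi> \<psi>)"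
| OrR2: "derivable Ax \<Gamma> \<psi> \<Longrightarrow> wf_fml \<phi> \<Longrightarrow> derivable Ax \<Gamma> (Or \<phi> \<psi>)"
| OrL: "derivable Ax (\<phi> # \<Gamma>) \<theta> \<Longrightarrow> derivable Ax (\<psi> # \<Gamma>) \<theta> \<Longrightarrow> derivable Ax (Or \<phi> \<psi> # \<Gamma>) \<theta>"
| ImpR: "derivable Ax (\<phi> # \<Gamma>) \<psi> \<Longrightarrow> derivable Ax \<Gamma> (Imp \<phi> \<psi>)"
| ImpL: "derivable Ax \<Gamma> \<phi> \<Longrightarrow> derivable Ax (\<psi> # \<Gamma>) \<theta> \<Longrightarrow> derivable Ax (Imp \<phi> \<psi> # \<Gamma>) \<theta>"
| IffR: "derivable Ax (\<phi> # \<Gamma>) \<psi> \<Longrightarrow> derivable Ax (\<psi> # \<Gamma>) \<phi> \<Longrightarrow> derivable Ax \<Gamma> (Iff \<phi> \<psi>)"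
| IffL: "derivable Ax (Imp \<phi> \<psi> # Imp \<psi> \<phi> # \<Gamma>) \<theta> \<Longrightarrow> derivable Ax (Iff \<phi> \<psi> # \<Gamma>) \<theta>"
| ForallR: "derivable Ax \<Gamma> \<psi> \<Longrightarrow> instance_of x (Var y) \<phi> \<psi> \<Longrightarrow>
     y \<notin> FV (Forall x \<phi>) \<union> \<Union> (FV ` set \<Gamma>) \<Longrightarrow> derivable Ax \<Gamma> (Forall x \<phi>)"
| ForallL: "derivable Ax (\<psi> # \<Gamma>) \<theta> \<Longrightarrow> instance_of x e \<phi> \<psi> \<Longrightarrow> derivable Ax (Forall x \<phi> # \<Gamma>) \<theta>"
| ExistsR: "derivable Ax \<Gamma> \<psi> \<Longrightarrow> instance_of x e \<phi> \<psi> \<Longrightarrow> derivable Ax \<Gamma> (Exists x \<phi>)"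
| ExistsL: "derivable Ax (\<psi> # \<Gamma>) \<theta> \<Longrightarrow> instance_of x (Var y) \<phi> \<psi> \<Longrightarrow>
     y \<notin> FV (Exists x \<phi>) \<union> \<Union> (FV ` set \<Gamma>) \<union> FV \<theta> \<Longrightarrow> derivable Ax (Exists x \<phi> # \<Gamma>) \<theta>"

abbreviation derivable_C0 :: "fml \<Rightarrow> bool" where
  "derivable_C0 \<phi> \<equiv> derivable axiom0 [] \<phi>"

abbreviation derivable_C1 :: "fml \<Rightarrow> bool" where
  "derivable_C1 \<phi> \<equiv> derivable axiom1 [] \<phi>"

end

theory Submission
  imports Defs
begin

text \<open>
  Sufficiency. Put \<open>e = (\<Sum>i<N. (L\<^sup>i p)\<^sup>2)\<close>. The rank identity and a polynomial bound on its
  cofactors give \<open>L e \<le> 2 h e\<close> for a polynomial \<open>h\<close> with rational coefficients. With the ghosts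
  \<open>z' = - h z\<close> and \<open>w' = h w\<close>, started at 1, the product \<open>z w\<close> stays 1 and \<open>e z\<^sup>2\<close> does not
  increase, so \<open>e\<close> stays 0. Using a sum of squares instead of the vector of the Lie derivatives
  avoids a matrix of ghosts and its determinant.

  Necessity. Suppose \<open>L\<^sup>k p = 0\<close> for \<open>k < i\<close> but \<open>L\<^sup>i p > 0\<close> initially. Since the domain is open,
  valid real arithmetic yields a ball around the initial state that lies in the domain and on which
  \<open>L\<^sup>i p\<close> is bounded below and the vector field is bounded. By (Cont) the flow leaves the initial
  state within the ball. Differential invariants for a clock \<open>t\<close> show that within the ball
  \<open>p\<close> grows at least like \<open>t\<^sup>i\<close> and that the state moves only if the clock does; this contradicts
  \<open>p = 0\<close>. The case \<open>L\<^sup>i p < 0\<close> is the same for \<open>- p\<close>.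
\<close>

subsection \<open>Polynomial evaluation\<close>

definition mon :: "(nat \<Rightarrow>\<^sub>0 nat) \<Rightarrow> state \<Rightarrow> real" where
  "mon m \<nu> = (\<Prod>x\<in>Poly_Mapping.keys m. \<nu> x ^ Poly_Mapping.lookup m x)"

text \<open>Exponents outside the support are 0 and contribute factors 1. This allows products over
  the supports of different monomials to be compared.\<close>

lemma mon_superset:
  assumes "finite A" "Poly_Mapping.keys m \<subseteq> A"
  shows "mon m \<nu> = (\<Prod>x\<in>A. \<nu> x ^ Poly_Mapping.lookup m x)"
  unfolding mon_def using assms by (intro prod.mono_neutral_left) (auto simp: in_keys_iff)

lemma mon_add: "mon (m + n) \<nu> = mon m \<nu> * mon n \<nu>"
proof -
  let ?A = "Poly_Mapping.keys m \<union> Poly_Mapping.keys n"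
  have "mon (m + n) \<nu> = (\<Prod>x\<in>?A. \<nu> x ^ Poly_Mapping.lookup (m + n) x)"
    by (rule mon_superset) (use Poly_Mapping.keys_add[of m n] in auto)
  also have "\<dots> = mon m \<nu> * mon n \<nu>"
    by (simp add: mon_superset[of ?A] lookup_add power_add prod.distrib)
  finally show ?thesis .
qed

lemma mon_0 [simp]: "mon 0 \<nu> = 1"
  by (simp add: mon_def)

lemma poly_eq_sum_single:
  "p = (\<Sum>m\<in>Poly_Mapping.keys p. Poly_Mapping.single m (Poly_Mapping.lookup p m))"
proof (rule poly_mapping_eqI)
  fix k
  have "(\<Sum>m\<in>Poly_Mapping.keys p. Poly_Mapping.lookup (Poly_Mapping.single m (Poly_Mapping.lookup p m)) k)
      = (\<Sum>m\<in>Poly_Mapping.keys p. if m = k then Poly_Mapping.lookup p m else 0)"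
    by (rule sum.cong) (auto simp: lookup_single when_def)
  also have "\<dots> = Poly_Mapping.lookup p k"
    by (simp add: in_keys_iff)
  finally show "Poly_Mapping.lookup p k = Poly_Mapping.lookup
      (\<Sum>m\<in>Poly_Mapping.keys p. Poly_Mapping.single m (Poly_Mapping.lookup p m)) k"
    by (simp add: lookup_sum)
qed

text \<open>Two coefficient rings are needed: the rationals for terms and the reals for the
  cofactors of the rank identity. Evaluation is shown to be a ring homomorphism for both at
  once.\<close>

locale coeff_hom =
  fixes c :: "'a::comm_ring_1 \<Rightarrow> real"
  assumes c_add: "c (a + b) = c a + c b" and c_mult: "c (a * b) = c a * c b" and c_1: "c 1 = 1"
begin

lemma c_0: "c 0 = 0"
  using c_add[of 0 0] by simp

definition ev :: "'a mpoly \<Rightarrow> state \<Rightarrow> real" where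
  "ev p \<nu> = (\<Sum>m\<in>Poly_Mapping.keys p. c (Poly_Mapping.lookup p m) * mon m \<nu>)"

lemma ev_0: "ev 0 \<nu> = 0"
  by (simp add: ev_def)

lemma ev_single: "ev (Poly_Mapping.single m a) \<nu> = c a * mon m \<nu>"
  by (cases "a = 0") (simp_all add: ev_def c_0)

lemma ev_1: "ev 1 \<nu> = 1"
  using ev_single[of 0 1] by (simp add: c_1)

lemma ev_add: "ev (p + q) \<nu> = ev p \<nu> + ev q \<nu>"
  unfolding ev_def
  by (rule setsum_keys_plus_distrib) (simp_all add: c_0 c_add distrib_right)

lemma ev_sum: "ev (\<Sum>i\<in>A. f i) \<nu> = (\<Sum>i\<in>A. ev (f i) \<nu>)"
  by (induction A rule: infinite_finite_induct) (simp_all add: ev_0 ev_add)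

text \<open>Both factors are expanded into single monomials, for which multiplicativity is
  \<open>mon_add\<close> and \<open>c_mult\<close>.\<close>

lemma ev_mult: "ev (p * q) \<nu> = ev p \<nu> * ev q \<nu>"
proof -
  have "ev (p * q) \<nu> = ev ((\<Sum>m\<in>Poly_Mapping.keys p. Poly_Mapping.single m (Poly_Mapping.lookup p m)) *
      (\<Sum>m\<in>Poly_Mapping.keys q. Poly_Mapping.single m (Poly_Mapping.lookup q m))) \<nu>"
    by (rule arg_cong2[where f = "\<lambda>a b. ev (a * b) \<nu>", OF poly_eq_sum_single poly_eq_sum_single])
  also have "\<dots> = ev p \<nu> * ev q \<nu>"
    by (simp add: sum_product ev_sum mult_single ev_single mon_add c_mult)
       (simp add: ev_def sum_product mult_ac)
  finally show ?thesis .
qed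

end

interpretation real_coeff: coeff_hom "\<lambda>x::real. x"
  by unfold_locales auto

interpretation rat_coeff: coeff_hom "of_rat :: rat \<Rightarrow> real"
  by unfold_locales (auto simp: of_rat_add of_rat_mult)

lemma teval_eq_ev: "teval p = rat_coeff.ev p"
  by (simp add: teval_def rat_coeff.ev_def mon_def fun_eq_iff)

text \<open>\<open>of_rat\<close> sends only 0 to 0, so the support is unchanged. This turns the
  rank identity, stated over the reals, into an equation between values of terms.\<close>

lemma ev_real_mpoly: "real_coeff.ev (real_mpoly p) \<nu> = teval p \<nu>"
proof -
  have "Poly_Mapping.lookup (real_mpoly p) m = of_rat (Poly_Mapping.lookup p m)" for m
    by (simp add: real_mpoly_def Poly_Mapping.map.rep_eq when_def)
  moreover from this have "Poly_Mapping.keys (real_mpoly p) = Poly_Mapping.keys p"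
    by (auto simp: in_keys_iff)
  ultimately show ?thesis
    by (simp add: teval_eq_ev rat_coeff.ev_def real_coeff.ev_def)
qed

lemma teval_0 [simp]: "teval 0 \<nu> = 0"
  and teval_1 [simp]: "teval 1 \<nu> = 1"
  and teval_add [simp]: "teval (p + q) \<nu> = teval p \<nu> + teval q \<nu>"
  and teval_mult [simp]: "teval (p * q) \<nu> = teval p \<nu> * teval q \<nu>"
  and teval_sum [simp]: "teval (\<Sum>i\<in>A. f i) \<nu> = (\<Sum>i\<in>A. teval (f i) \<nu>)"
  by (simp_all add: teval_eq_ev rat_coeff.ev_0 rat_coeff.ev_1 rat_coeff.ev_add rat_coeff.ev_mult
      rat_coeff.ev_sum)

lemma teval_single [simp]: "teval (Poly_Mapping.single m a) \<nu> = of_rat a * mon m \<nu>"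
  by (simp add: teval_eq_ev rat_coeff.ev_single)

lemma teval_Var [simp]: "teval (Var x) \<nu> = \<nu> x"
  by (simp add: Var_def mon_def)

lemma teval_uminus [simp]: "teval (- p) \<nu> = - teval p \<nu>"
  using teval_add[of "- p" p \<nu>] by (simp del: teval_add)

lemma teval_diff [simp]: "teval (p - q) \<nu> = teval p \<nu> - teval q \<nu>"
  using teval_add[of p "- q" \<nu>] by (simp del: teval_add)

lemma teval_power [simp]: "teval (p ^ n) \<nu> = teval p \<nu> ^ n"
  by (induction n) simp_all

lemma teval_of_nat [simp]: "teval (of_nat n) \<nu> = of_nat n"
  by (induction n) simp_all

lemma teval_numeral [simp]: "teval (numeral k) \<nu> = numeral k"
  using teval_of_nat[of "numeral k" \<nu>] by simp

lemma teval_fact [simp]: "teval (fact n) \<nu> = fact n"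
  using teval_of_nat[of "fact n" \<nu>] by simp

lemma teval_prod [simp]: "teval (\<Prod>i\<in>A. f i) \<nu> = (\<Prod>i\<in>A. teval (f i) \<nu>)"
  by (induction A rule: infinite_finite_induct) simp_all

lemma teval_sum_list: "teval (sum_list ps) \<nu> = (\<Sum>p\<leftarrow>ps. teval p \<nu>)"
  by (induction ps) simp_all

lemma teval_coincidence:
  assumes "\<forall>x\<in>indets p. \<nu> x = \<mu> x"
  shows "teval p \<nu> = teval p \<mu>"
  unfolding teval_def using assms
  by (intro sum.cong prod.cong arg_cong2[where f = "(*)"] refl) (auto simp: indets_def)

lemma continuous_on_teval: "continuous_on UNIV (teval p)"
  unfolding teval_def by (intro continuous_intros continuous_on_product_coordinates)


subsection \<open>Indeterminates\<close>

lemma finite_indets [simp]: "finite (indets p)"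
  by (simp add: indets_def)

lemma indets_0 [simp]: "indets 0 = {}"
  and indets_1 [simp]: "indets (1 :: 'a::zero_neq_one mpoly) = {}"
  and indets_uminus [simp]: "indets (- q) = indets (q :: 'b::ab_group_add mpoly)"
  by (simp_all add: indets_def)

lemma indets_Var [simp]: "indets (Var x) = {x}"
  by (simp add: indets_def Var_def)

lemma indets_subset_iff: "indets p \<subseteq> X \<longleftrightarrow> (\<forall>m\<in>Poly_Mapping.keys p. Poly_Mapping.keys m \<subseteq> X)"
  by (auto simp: indets_def)

text \<open>Cancellation can make indeterminates disappear, so inclusions are used; with a common
  bound \<open>X\<close> they chain as introduction rules.\<close>

lemma indets_add_subset: "indets p \<subseteq> X \<Longrightarrow> indets q \<subseteq> X \<Longrightarrow> indets (p + q) \<subseteq> X"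
  unfolding indets_subset_iff using Poly_Mapping.keys_add[of p q] by blast

lemma indets_diff_subset: "indets (p :: trm) \<subseteq> X \<Longrightarrow> indets q \<subseteq> X \<Longrightarrow> indets (p - q) \<subseteq> X"
  using indets_add_subset[of p X "- q"] by simp

lemma indets_mult_subset: "indets (p :: trm) \<subseteq> X \<Longrightarrow> indets q \<subseteq> X \<Longrightarrow> indets (p * q) \<subseteq> X"
  unfolding indets_subset_iff
proof
  fix m
  assume *: "\<forall>m\<in>Poly_Mapping.keys p. Poly_Mapping.keys m \<subseteq> X"
    "\<forall>m\<in>Poly_Mapping.keys q. Poly_Mapping.keys m \<subseteq> X" "m \<in> Poly_Mapping.keys (p * q)"
  then obtain a b where "m = a + b" "a \<in> Poly_Mapping.keys p" "b \<in> Poly_Mapping.keys q"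
    using keys_mult[of p q] by blast
  then show "Poly_Mapping.keys m \<subseteq> X"
    using * Poly_Mapping.keys_add[of a b] by blast
qed

lemma indets_sum_subset: "(\<And>i. i \<in> A \<Longrightarrow> indets (f i) \<subseteq> X) \<Longrightarrow> indets (\<Sum>i\<in>A. f i) \<subseteq> X"
  by (induction A rule: infinite_finite_induct) (simp_all add: indets_add_subset)

lemma indets_power_subset: "indets (p :: trm) \<subseteq> X \<Longrightarrow> indets (p ^ n) \<subseteq> X"
  by (induction n) (simp_all add: indets_mult_subset)

lemma indets_of_nat [simp]: "indets (of_nat n :: trm) = {}"
proof (induction n)
  case (Suc n)
  then show ?case using indets_add_subset[of "1 :: trm" "{}" "of_nat n"] by simp
qed simp

lemma indets_numeral [simp]: "indets (numeral k :: trm) = {}"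
  using indets_of_nat[of "numeral k"] by simp

lemmas indets_subset_intros =
  indets_add_subset indets_diff_subset indets_mult_subset indets_sum_subset
  indets_power_subset


subsection \<open>Partial and Lie derivatives\<close>

lemma DERIV_mon:
  "((\<lambda>r. mon m (\<nu>(x := r))) has_real_derivative
     of_nat (Poly_Mapping.lookup m x) * mon (m - Poly_Mapping.single x 1) \<nu>) (at (\<nu> x))"
proof -
  let ?A = "insert x (Poly_Mapping.keys m)" and ?k = "Poly_Mapping.lookup m x"
  define C where "C = (\<Prod>y\<in>?A - {x}. \<nu> y ^ Poly_Mapping.lookup m y)"
  have 1: "mon m (\<nu>(x := r)) = r ^ ?k * C" for r
  proof -
    have "mon m (\<nu>(x := r)) = (\<Prod>y\<in>?A. (\<nu>(x := r)) y ^ Poly_Mapping.lookup m y)"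
      by (rule mon_superset) auto
    also have "\<dots> = r ^ ?k * (\<Prod>y\<in>?A - {x}. (\<nu>(x := r)) y ^ Poly_Mapping.lookup m y)"
      by (subst prod.remove[of _ x]) auto
    also have "\<dots> = r ^ ?k * C"
      unfolding C_def by (intro arg_cong2[where f = "(*)"] prod.cong) auto
    finally show ?thesis .
  qed
  \<comment> \<open>Subtraction of exponents is truncated: if \<open>x\<close> does not occur in
    \<open>m\<close>, this is \<open>mon m \<nu>\<close>, and the factor \<open>?k = 0\<close> of
    the claimed derivative removes it.\<close>
  have 2: "mon (m - Poly_Mapping.single x 1) \<nu> = \<nu> x ^ (?k - 1) * C"
  proof -
    have "mon (m - Poly_Mapping.single x 1) \<nu> =
        (\<Prod>y\<in>?A. \<nu> y ^ Poly_Mapping.lookup (m - Poly_Mapping.single x 1) y)"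
      by (rule mon_superset) (auto simp: in_keys_iff lookup_minus)
    also have "\<dots> = \<nu> x ^ (?k - 1) *
        (\<Prod>y\<in>?A - {x}. \<nu> y ^ Poly_Mapping.lookup (m - Poly_Mapping.single x 1) y)"
      by (subst prod.remove[of _ x]) (auto simp: lookup_minus)
    also have "\<dots> = \<nu> x ^ (?k - 1) * C"
      unfolding C_def
      by (intro arg_cong2[where f = "(*)"] prod.cong) (auto simp: lookup_minus lookup_single)
    finally show ?thesis .
  qed
  show ?thesis
    unfolding 1 2 by (auto intro!: derivative_eq_intros)
qed

lemma DERIV_teval:
  "((\<lambda>r. teval p (\<nu>(x := r))) has_real_derivative teval (pdiff x p) \<nu>) (at (\<nu> x))"
proof -
  have "((\<lambda>r. \<Sum>m\<in>Poly_Mapping.keys p. of_rat (Poly_Mapping.lookup p m) * mon m (\<nu>(x := r)))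
    has_real_derivative (\<Sum>m\<in>Poly_Mapping.keys p. of_rat (Poly_Mapping.lookup p m) *
      (of_nat (Poly_Mapping.lookup m x) * mon (m - Poly_Mapping.single x 1) \<nu>))) (at (\<nu> x))"
    by (intro DERIV_sum DERIV_cmult DERIV_mon)
  moreover have "teval (pdiff x p) \<nu> = (\<Sum>m\<in>Poly_Mapping.keys p. of_rat (Poly_Mapping.lookup p m) *
      (of_nat (Poly_Mapping.lookup m x) * mon (m - Poly_Mapping.single x 1) \<nu>))"
    by (simp add: pdiff_def of_rat_mult mult_ac)
  ultimately show ?thesis
    by (simp add: teval_def mon_def)
qed

text \<open>Uniqueness of derivatives lets the sum and product rules for \<open>pdiff\<close> be
  read off from calculus. They are equalities of values, which suffices because arithmetic axioms
  are justified semantically.\<close>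

lemma teval_pdiff_eqI:
  "((\<lambda>r. teval p (\<nu>(x := r))) has_real_derivative D) (at (\<nu> x)) \<Longrightarrow> teval (pdiff x p) \<nu> = D"
  using DERIV_teval DERIV_unique by blast

lemma teval_pdiff_add: "teval (pdiff x (p + q)) \<nu> = teval (pdiff x p) \<nu> + teval (pdiff x q) \<nu>"
  by (rule teval_pdiff_eqI) (auto intro!: derivative_eq_intros DERIV_teval)

lemma teval_pdiff_uminus: "teval (pdiff x (- p)) \<nu> = - teval (pdiff x p) \<nu>"
  by (rule teval_pdiff_eqI) (auto intro!: derivative_eq_intros DERIV_teval)

lemma teval_pdiff_mult:
  "teval (pdiff x (p * q)) \<nu> = teval (pdiff x p) \<nu> * teval q \<nu> + teval p \<nu> * teval (pdiff x q) \<nu>"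
  by (rule teval_pdiff_eqI) (auto intro!: derivative_eq_intros DERIV_teval)

lemma teval_pdiff_notin: "x \<notin> indets p \<Longrightarrow> teval (pdiff x p) \<nu> = 0"
proof (rule teval_pdiff_eqI)
  assume "x \<notin> indets p"
  then have "teval p (\<nu>(x := r)) = teval p \<nu>" for r
    by (intro teval_coincidence) auto
  then show "((\<lambda>r. teval p (\<nu>(x := r))) has_real_derivative 0) (at (\<nu> x))"
    by simp
qed

lemma teval_pdiff_Var: "teval (pdiff x (Var y)) \<nu> = (if x = y then 1 else 0)"
  by (rule teval_pdiff_eqI) auto

lemma teval_lie: "teval (lie ode p) \<nu> = (\<Sum>(x, e)\<leftarrow>ode. teval (pdiff x p) \<nu> * teval e \<nu>)"
  unfolding lie_def teval_sum_list map_map by (rule arg_cong[where f = sum_list]) auto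

lemma teval_lie_add [simp]:
  "teval (lie ode (p + q)) \<nu> = teval (lie ode p) \<nu> + teval (lie ode q) \<nu>"
  unfolding teval_lie by (induction ode) (auto simp: teval_pdiff_add algebra_simps)

lemma teval_lie_uminus [simp]: "teval (lie ode (- p)) \<nu> = - teval (lie ode p) \<nu>"
  unfolding teval_lie by (induction ode) (auto simp: teval_pdiff_uminus algebra_simps)

lemma teval_lie_diff [simp]:
  "teval (lie ode (p - q)) \<nu> = teval (lie ode p) \<nu> - teval (lie ode q) \<nu>"
  using teval_lie_add[of ode p "- q"] by (simp del: teval_lie_add)

lemma teval_lie_mult [simp]:
  "teval (lie ode (p * q)) \<nu> = teval (lie ode p) \<nu> * teval q \<nu> + teval p \<nu> * teval (lie ode q) \<nu>"
  unfolding teval_lie by (induction ode) (auto simp: teval_pdiff_mult algebra_simps)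

lemma teval_lie_const: "indets p \<inter> fst ` set ode = {} \<Longrightarrow> teval (lie ode p) \<nu> = 0"
  unfolding teval_lie by (induction ode) (auto simp: teval_pdiff_notin)

lemma teval_lie_of_nat [simp]: "teval (lie ode (of_nat n)) \<nu> = 0"
  by (rule teval_lie_const) simp

lemma teval_lie_fact [simp]: "teval (lie ode (fact n)) \<nu> = 0"
  using teval_lie_of_nat[of ode "fact n" \<nu>] by simp

lemma teval_lie_0 [simp]: "teval (lie ode 0) \<nu> = 0"
  and teval_lie_1 [simp]: "teval (lie ode 1) \<nu> = 0"
  by (rule teval_lie_const, simp)+

lemma teval_lie_sum [simp]: "teval (lie ode (\<Sum>i\<in>A. f i)) \<nu> = (\<Sum>i\<in>A. teval (lie ode (f i)) \<nu>)"
  by (induction A rule: infinite_finite_induct) simp_all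

lemma teval_lie_power [simp]:
  "teval (lie ode (p ^ n)) \<nu> = of_nat n * teval p \<nu> ^ (n - 1) * teval (lie ode p) \<nu>"
proof (induction n)
  case (Suc n)
  then show ?case by (cases n) (simp_all add: algebra_simps)
qed simp

text \<open>As the left-hand sides are distinct, exactly one equation contributes to the
  sum.\<close>

lemma teval_lie_Var:
  "distinct (map fst ode) \<Longrightarrow> (x, e) \<in> set ode \<Longrightarrow> teval (lie ode (Var x)) \<nu> = teval e \<nu>"
proof (induction ode)
  case (Cons a ode)
  have "teval (lie ode (Var x)) \<nu> = 0" if "x \<notin> fst ` set ode"
    using that by (intro teval_lie_const) auto
  with Cons show ?case
    by (cases a) (force simp: lie_def teval_pdiff_Var)
qed simp

lemma teval_lie_append:
  "teval (lie (ode @ ode') p) \<nu> = teval (lie ode p) \<nu> + teval (lie ode' p) \<nu>"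
  by (simp add: lie_def)

lemma indets_pdiff: "indets (pdiff x p) \<subseteq> indets p"
  unfolding pdiff_def
  by (intro indets_sum_subset) (auto simp: indets_def in_keys_iff lookup_minus lookup_single)

lemma indets_lie: "indets p \<subseteq> X \<Longrightarrow> \<forall>e\<in>snd ` set ode. indets e \<subseteq> X \<Longrightarrow> indets (lie ode p) \<subseteq> X"
proof (induction ode)
  case (Cons a ode)
  then have "indets (pdiff (fst a) p * snd a + lie ode p) \<subseteq> X"
    using indets_pdiff[of "fst a" p]
    by (intro indets_add_subset indets_mult_subset) auto
  then show ?case by (simp add: lie_def split_beta)
qed (simp add: lie_def)

lemma indets_lie_funpow:
  "indets p \<subseteq> X \<Longrightarrow> \<forall>e\<in>snd ` set ode. indets e \<subseteq> X \<Longrightarrow> indets ((lie ode ^^ i) p) \<subseteq> X"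
  by (induction i) (simp_all add: indets_lie)


subsection \<open>Semantics and free variables of formulas\<close>

lemma fo_imp_wf: "fo \<phi> \<Longrightarrow> wf_fml \<phi>"
  by (induction \<phi> rule: fml.induct[where ?P2.0 = "\<lambda>_. True"]) auto

text \<open>Formulas and programs are mutually recursive; programs get a trivial induction predicate
  because \<open>fo\<close> excludes modalities.\<close>

lemma sat_coincidence:
  "fo \<phi> \<Longrightarrow> \<forall>x\<in>FV \<phi>. \<nu> x = \<mu> x \<Longrightarrow> sat \<phi> \<nu> = sat \<phi> \<mu>"
proof (induction \<phi> arbitrary: \<nu> \<mu> rule: fml.induct[where ?P2.0 = "\<lambda>_. True"])
  case (Eq a b)
  then show ?case using teval_coincidence[of a \<nu> \<mu>] teval_coincidence[of b \<nu> \<mu>] by simp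
next
  case (Geq a b)
  then show ?case using teval_coincidence[of a \<nu> \<mu>] teval_coincidence[of b \<nu> \<mu>] by simp
next
  case (Gt a b)
  then show ?case using teval_coincidence[of a \<nu> \<mu>] teval_coincidence[of b \<nu> \<mu>] by simp
next
  case (Neg \<phi>)
  then show ?case using Neg.IH[of \<nu> \<mu>] by simp
next
  case (And \<phi> \<psi>)
  show ?case using And.IH(1)[of \<nu> \<mu>] And.IH(2)[of \<nu> \<mu>] And.prems by simp
next
  case (Or \<phi> \<psi>)
  show ?case using Or.IH(1)[of \<nu> \<mu>] Or.IH(2)[of \<nu> \<mu>] Or.prems by simp
next
  case (Imp \<phi> \<psi>)
  show ?case using Imp.IH(1)[of \<nu> \<mu>] Imp.IH(2)[of \<nu> \<mu>] Imp.prems by simp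
next
  case (Iff \<phi> \<psi>)
  show ?case using Iff.IH(1)[of \<nu> \<mu>] Iff.IH(2)[of \<nu> \<mu>] Iff.prems by simp
next
  case (Forall x \<phi>)
  then have "sat \<phi> (\<nu>(x := r)) = sat \<phi> (\<mu>(x := r))" for r
    by (intro Forall.IH) auto
  then show ?case by simp
next
  case (Exists x \<phi>)
  then have "sat \<phi> (\<nu>(x := r)) = sat \<phi> (\<mu>(x := r))" for r
    by (intro Exists.IH) auto
  then show ?case by simp
qed auto

lemma finite_ode_vars: "finite (ode_vars ode)"
  by (auto simp: ode_vars_def)

lemma finite_vars: "finite (vars \<phi>)"
  by (induction \<phi> rule: fml.induct[where ?P2.0 = "\<lambda>\<alpha>. finite (vars_prog \<alpha>)"])
    (auto simp: finite_ode_vars)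

lemma finite_FV: "finite (FV \<phi>)"
  by (induction \<phi> rule: fml.induct[where ?P2.0 = "\<lambda>\<alpha>. finite (FV_prog \<alpha>)"])
    (auto simp: finite_ode_vars)

lemma fresh_list:
  assumes "finite (X :: nat set)"
  obtains vs where "length vs = n" "distinct vs" "set vs \<inter> X = {}"
proof -
  obtain m where "\<forall>x\<in>X. x < m"
    using assms finite_nat_set_iff_bounded by auto
  then show ?thesis
    by (intro that[of "[m..<m + n]"]) auto
qed

lemma sat_foldr_Exists:
  "sat (foldr Exists vs \<phi>) \<nu> \<longleftrightarrow> (\<exists>\<mu>. (\<forall>x. x \<notin> set vs \<longrightarrow> \<mu> x = \<nu> x) \<and> sat \<phi> \<mu>)"
proof (induction vs arbitrary: \<nu>)
  case Nil
  have "(\<forall>x. \<mu> x = \<nu> x) \<longleftrightarrow> \<mu> = \<nu>" for \<mu> by auto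
  then show ?case by simp
next
  case (Cons v vs)
  show ?case
  proof
    assume "sat (foldr Exists (v # vs) \<phi>) \<nu>"
    then obtain r \<mu> where "\<forall>x. x \<notin> set vs \<longrightarrow> \<mu> x = (\<nu>(v := r)) x" "sat \<phi> \<mu>"
      using Cons by auto
    then show "\<exists>\<mu>. (\<forall>x. x \<notin> set (v # vs) \<longrightarrow> \<mu> x = \<nu> x) \<and> sat \<phi> \<mu>"
      by (intro exI[of _ \<mu>]) auto
  next
    assume "\<exists>\<mu>. (\<forall>x. x \<notin> set (v # vs) \<longrightarrow> \<mu> x = \<nu> x) \<and> sat \<phi> \<mu>"
    then obtain \<mu> where "\<forall>x. x \<notin> set (v # vs) \<longrightarrow> \<mu> x = \<nu> x" "sat \<phi> \<mu>" by blast
    then have "sat (foldr Exists vs \<phi>) (\<nu>(v := \<mu> v))"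
      using Cons by auto
    then show "sat (foldr Exists (v # vs) \<phi>) \<nu>" by auto
  qed
qed

lemma sat_foldr_Forall:
  "sat (foldr Forall vs \<phi>) \<nu> \<longleftrightarrow> (\<forall>\<mu>. (\<forall>x. x \<notin> set vs \<longrightarrow> \<mu> x = \<nu> x) \<longrightarrow> sat \<phi> \<mu>)"
proof -
  have "sat (foldr Forall vs \<phi>) \<nu> \<longleftrightarrow> \<not> sat (foldr Exists vs (Neg \<phi>)) \<nu>" for \<nu>
    by (induction vs arbitrary: \<nu>) auto
  then show ?thesis by (auto simp: sat_foldr_Exists)
qed

lemma fo_foldr_Exists [simp]: "fo (foldr Exists vs \<phi>) = fo \<phi>"
  and fo_foldr_Forall [simp]: "fo (foldr Forall vs \<phi>) = fo \<phi>"
  and wf_foldr_Exists [simp]: "wf_fml (foldr Exists vs \<phi>) = wf_fml \<phi>"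
  and FV_foldr_Exists [simp]: "FV (foldr Exists vs \<phi>) = FV \<phi> - set vs"
  and FV_foldr_Forall [simp]: "FV (foldr Forall vs \<phi>) = FV \<phi> - set vs"
  by (induction vs) auto

lemma sat_Conj [simp]: "sat (Conj \<phi>s) \<nu> \<longleftrightarrow> (\<forall>\<phi>\<in>set \<phi>s. sat \<phi> \<nu>)"
  by (induction \<phi>s rule: Conj.induct) (auto simp: TT_def)

lemma fo_Conj [simp]: "fo (Conj \<phi>s) \<longleftrightarrow> (\<forall>\<phi>\<in>set \<phi>s. fo \<phi>)"
  by (induction \<phi>s rule: Conj.induct) (auto simp: TT_def)

lemma FV_Conj [simp]: "FV (Conj \<phi>s) = \<Union> (FV ` set \<phi>s)"
  by (induction \<phi>s rule: Conj.induct) (auto simp: TT_def)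

lemma fo_FF [simp]: "fo FF" and FV_FF [simp]: "FV FF = {}" and sat_FF [simp]: "\<not> sat FF \<nu>"
  by (simp_all add: FF_def TT_def)

lemma fo_EqV [simp]: "fo (EqV xs ys)"
  by (auto simp: EqV_def)

lemma sat_EqV:
  "length xs = length ys \<Longrightarrow> sat (EqV xs ys) \<nu> \<longleftrightarrow> (\<forall>i<length xs. \<nu> (xs ! i) = \<nu> (ys ! i))"
  by (auto simp: EqV_def set_zip)

lemma FV_EqV: "FV (EqV xs ys) \<subseteq> set xs \<union> set ys"
  by (auto simp: EqV_def dest: set_zip_leftD set_zip_rightD)


subsection \<open>Derived rules\<close>

abbreviation derives :: "fml list \<Rightarrow> fml \<Rightarrow> bool" (infix "\<turnstile>" 45) where
  "\<Gamma> \<turnstile> \<phi> \<equiv> derivable axiom1 \<Gamma> \<phi>"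

abbreviation wfs :: "fml list \<Rightarrow> bool" where
  "wfs \<Gamma> \<equiv> \<forall>\<psi>\<in>set \<Gamma>. wf_fml \<psi>"

lemma derive_axiom0: "axiom0 \<phi> \<Longrightarrow> wf_fml \<phi> \<Longrightarrow> wfs \<Gamma> \<Longrightarrow> \<Gamma> \<turnstile> \<phi>"
  by (rule derivable.Weaken[OF derivable.Axiom]) (auto intro: axiom1.Base)

lemma derive_axiom1: "axiom1 \<phi> \<Longrightarrow> wf_fml \<phi> \<Longrightarrow> wfs \<Gamma> \<Longrightarrow> \<Gamma> \<turnstile> \<phi>"
  by (rule derivable.Weaken[OF derivable.Axiom]) auto

lemma derive_assumption: "\<phi> \<in> set \<Gamma> \<Longrightarrow> wfs \<Gamma> \<Longrightarrow> \<Gamma> \<turnstile> \<phi>"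
  by (rule derivable.Weaken[OF derivable.Id]) auto

lemma derive_mp:
  assumes "\<Gamma> \<turnstile> Imp \<phi> \<psi>" "\<Gamma> \<turnstile> \<phi>" "wfs \<Gamma>" "wf_fml \<psi>"
  shows "\<Gamma> \<turnstile> \<psi>"
  by (rule derivable.Cut[OF assms(1)], rule derivable.ImpL[OF assms(2)],
      rule derive_assumption) (use assms in auto)

lemma derive_mps:
  assumes "\<Gamma> \<turnstile> foldr Imp \<Delta> \<psi>" "\<forall>\<phi>\<in>set \<Delta>. \<Gamma> \<turnstile> \<phi>" "wfs \<Gamma>" "wfs \<Delta>" "wf_fml \<psi>"
  shows "\<Gamma> \<turnstile> \<psi>"
  using assms
proof (induction \<Delta>)
  case (Cons \<phi> \<Delta>)
  have "wf_fml (foldr Imp \<Delta> \<psi>)"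
    using Cons.prems(4,5) by (induction \<Delta>) auto
  then show ?case
    using Cons by (auto intro: derive_mp)
qed simp

lemma derive_cuts:
  assumes "\<Delta> \<turnstile> \<psi>" "\<forall>\<phi>\<in>set \<Delta>. \<Gamma> \<turnstile> \<phi>" "wfs \<Gamma>" "wfs \<Delta>" "wf_fml \<psi>"
  shows "\<Gamma> \<turnstile> \<psi>"
proof -
  \<comment> \<open>\<open>ImpR\<close> discharges the head of the antecedent first, so the head
    ends up innermost in the chain of implications; hence the reversal.\<close>
  have "[] \<turnstile> foldr Imp \<Delta>' \<theta>" if "rev \<Delta>' \<turnstile> \<theta>" for \<Delta>' \<theta>
    using that
  proof (induction \<Delta>' arbitrary: \<theta> rule: rev_induct)
    case (snoc \<phi> \<Delta>')
    then show ?case by (auto intro: derivable.ImpR)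
  qed simp
  from this[of "rev \<Delta>" \<psi>] assms(1,3) have "\<Gamma> \<turnstile> foldr Imp (rev \<Delta>) \<psi>"
    by (auto intro: derivable.Weaken)
  then show ?thesis
    by (rule derive_mps) (use assms in auto)
qed

lemma derive_arith_axiom:
  "\<forall>\<nu>. (\<forall>\<phi>\<in>set \<Delta>. sat \<phi> \<nu>) \<longrightarrow> sat \<psi> \<nu> \<Longrightarrow> \<forall>\<phi>\<in>set \<Delta>. fo \<phi> \<Longrightarrow> fo \<psi> \<Longrightarrow> [] \<turnstile> foldr Imp \<Delta> \<psi>"
proof -
  assume *: "\<forall>\<nu>. (\<forall>\<phi>\<in>set \<Delta>. sat \<phi> \<nu>) \<longrightarrow> sat \<psi> \<nu>" "\<forall>\<phi>\<in>set \<Delta>. fo \<phi>" "fo \<psi>"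
  have "sat (foldr Imp \<Delta> \<psi>) \<nu> \<longleftrightarrow> (\<forall>\<phi>\<in>set \<Delta>. sat \<phi> \<nu>) \<longrightarrow> sat \<psi> \<nu>" for \<nu>
    by (induction \<Delta>) auto
  moreover have "fo (foldr Imp \<Delta> \<psi>)"
    using *(2,3) by (induction \<Delta>) auto
  ultimately show ?thesis
    using *(1) by (intro derive_axiom0 axiom0.Arith fo_imp_wf) auto
qed

text \<open>Since valid real arithmetic is axiomatic, a first-order step of a derivation becomes a
  purely semantic goal about states.\<close>

lemma derive_arith:
  assumes "\<And>\<nu>. \<forall>\<phi>\<in>set \<Delta>. sat \<phi> \<nu> \<Longrightarrow> sat \<psi> \<nu>"
    and "\<forall>\<phi>\<in>set \<Delta>. \<Gamma> \<turnstile> \<phi>" "wfs \<Gamma>" "\<forall>\<phi>\<in>set \<Delta>. fo \<phi>" "fo \<psi>"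
  shows "\<Gamma> \<turnstile> \<psi>"
proof (rule derive_mps)
  show "\<Gamma> \<turnstile> foldr Imp \<Delta> \<psi>"
    using assms(1,3,4,5) by (intro derivable.Weaken[OF derive_arith_axiom]) auto
qed (use assms in \<open>auto intro: fo_imp_wf\<close>)

text \<open>(G) puts the valid implication chain under the box, and (K) then removes one premise at
  a time.\<close>

lemma derive_box_arith:
  assumes "\<And>\<nu>. \<forall>\<phi>\<in>set \<Delta>. sat \<phi> \<nu> \<Longrightarrow> sat \<psi> \<nu>"
    and "\<forall>\<phi>\<in>set \<Delta>. \<Gamma> \<turnstile> Box \<alpha> \<phi>" "wfs \<Gamma>" "\<forall>\<phi>\<in>set \<Delta>. fo \<phi>" "fo \<psi>" "wf_prog \<alpha>"
  shows "\<Gamma> \<turnstile> Box \<alpha> \<psi>"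
proof -
  have "[] \<turnstile> Box \<alpha> (foldr Imp \<Delta> \<psi>)"
    using assms by (intro derivable.G derive_arith_axiom) auto
  then have "\<Gamma> \<turnstile> Box \<alpha> (foldr Imp \<Delta> \<psi>)"
    by (rule derivable.Weaken) (use assms in auto)
  then show ?thesis
    using assms(2,4)
  proof (induction \<Delta>)
    case (Cons \<phi> \<Delta>)
    have "fo (foldr Imp \<Delta> \<psi>)"
      using Cons.prems(3) assms(5) by (induction \<Delta>) auto
    then have wf: "wf_fml (foldr Imp \<Delta> \<psi>)" "wf_fml \<phi>" "wf_fml (Box \<alpha> \<phi>)"
      using Cons.prems assms by (auto intro: fo_imp_wf)
    have "\<Gamma> \<turnstile> Imp (Box \<alpha> (Imp \<phi> (foldr Imp \<Delta> \<psi>))) (Imp (Box \<alpha> \<phi>) (Box \<alpha> (foldr Imp \<Delta> \<psi>)))"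
      using wf assms by (intro derive_axiom0 axiom0.K) auto
    then have "\<Gamma> \<turnstile> Imp (Box \<alpha> \<phi>) (Box \<alpha> (foldr Imp \<Delta> \<psi>))"
      by (rule derive_mp) (use Cons.prems wf assms in auto)
    then have "\<Gamma> \<turnstile> Box \<alpha> (foldr Imp \<Delta> \<psi>)"
      by (rule derive_mp) (use Cons.prems wf assms in auto)
    then show ?case
      using Cons by auto
  qed simp
qed

lemma derive_IffD1: "\<Gamma> \<turnstile> Iff \<phi> \<psi> \<Longrightarrow> \<Gamma> \<turnstile> \<phi> \<Longrightarrow> wfs \<Gamma> \<Longrightarrow> wf_fml \<phi> \<Longrightarrow> wf_fml \<psi> \<Longrightarrow> \<Gamma> \<turnstile> \<psi>"
proof -
  assume *: "\<Gamma> \<turnstile> Iff \<phi> \<psi>" "\<Gamma> \<turnstile> \<phi>" "wfs \<Gamma>" "wf_fml \<phi>" "wf_fml \<psi>"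
  have "\<Gamma> \<turnstile> Imp \<phi> \<psi>"
    by (rule derivable.Cut[OF *(1)], rule derivable.IffL, rule derive_assumption) (use * in auto)
  then show ?thesis by (rule derive_mp) (use * in auto)
qed

lemma derive_IffD2: "\<Gamma> \<turnstile> Iff \<phi> \<psi> \<Longrightarrow> \<Gamma> \<turnstile> \<psi> \<Longrightarrow> wfs \<Gamma> \<Longrightarrow> wf_fml \<phi> \<Longrightarrow> wf_fml \<psi> \<Longrightarrow> \<Gamma> \<turnstile> \<phi>"
proof -
  assume *: "\<Gamma> \<turnstile> Iff \<phi> \<psi>" "\<Gamma> \<turnstile> \<psi>" "wfs \<Gamma>" "wf_fml \<phi>" "wf_fml \<psi>"
  have "\<Gamma> \<turnstile> Imp \<psi> \<phi>"
    by (rule derivable.Cut[OF *(1)], rule derivable.IffL, rule derive_assumption) (use * in auto)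
  then show ?thesis by (rule derive_mp) (use * in auto)
qed

lemma derive_NegD:
  assumes "\<Gamma> \<turnstile> Neg \<phi>" "\<Gamma> \<turnstile> \<phi>"
  shows "\<Gamma> \<turnstile> FF"
  by (rule derivable.Cut[OF assms(1)], rule derivable.NegL[OF assms(2)]) (simp add: FF_def TT_def)

text \<open>
  The eigenvariables are the bound variables themselves: an ODE may bind them, so that no proper
  renaming would be admissible.
\<close>

lemma derive_ExistsE:
  "\<phi> # \<Gamma> \<turnstile> \<theta> \<Longrightarrow> set vs \<inter> (\<Union> (FV ` set \<Gamma>) \<union> FV \<theta>) = {} \<Longrightarrow> foldr Exists vs \<phi> # \<Gamma> \<turnstile> \<theta>"
proof (induction vs)
  case (Cons v vs)
  then show ?case
    by (auto intro!: derivable.ExistsL[where y = v and \<psi> = "foldr Exists vs \<phi>"] simp: instance_of_def)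
qed simp

lemma derive_ExistsI: "\<Gamma> \<turnstile> \<phi> \<Longrightarrow> \<Gamma> \<turnstile> foldr Exists vs \<phi>"
  by (induction vs) (auto intro!: derivable.ExistsR simp: instance_of_def)

text \<open>Once the sign of the Lie derivative is known along the flow, (DI) leaves only the
  initial value to be checked.\<close>

lemma derive_DI_Geq:
  assumes "\<Gamma> \<turnstile> Box (ODE ode Q) (Geq (lie ode p) 0)" "\<Gamma> \<turnstile> Imp Q (Geq p 0)"
    "wfs \<Gamma>" "wf_prog (ODE ode Q)"
  shows "\<Gamma> \<turnstile> Box (ODE ode Q) (Geq p 0)"
proof -
  have wf: "wf_fml Q" using assms(4) by (auto intro: fo_imp_wf)
  have "\<Gamma> \<turnstile> Imp Q (Box (ODE ode Q) (Geq (lie ode p) 0))"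
    by (intro derivable.ImpR derivable.Weaken[OF assms(1)]) (use assms wf in auto)
  moreover have "\<Gamma> \<turnstile> Imp (Imp Q (Box (ODE ode Q) (Geq (lie ode p) 0)))
     (Iff (Box (ODE ode Q) (Geq p 0)) (Imp Q (Geq p 0)))"
    using assms wf by (intro derive_axiom0 axiom0.DI_Geq) auto
  ultimately have "\<Gamma> \<turnstile> Iff (Box (ODE ode Q) (Geq p 0)) (Imp Q (Geq p 0))"
    using derive_mp assms wf by auto
  then show ?thesis
    by (rule derive_IffD2) (use assms wf in auto)
qed

lemma derive_DI_Eq:
  assumes "\<Gamma> \<turnstile> Box (ODE ode Q) (Eq (lie ode p) 0)" "\<Gamma> \<turnstile> Imp Q (Eq p 0)"
    "wfs \<Gamma>" "wf_prog (ODE ode Q)"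
  shows "\<Gamma> \<turnstile> Box (ODE ode Q) (Eq p 0)"
proof -
  have wf: "wf_fml Q" using assms(4) by (auto intro: fo_imp_wf)
  have "\<Gamma> \<turnstile> Imp Q (Box (ODE ode Q) (Eq (lie ode p) 0))"
    by (intro derivable.ImpR derivable.Weaken[OF assms(1)]) (use assms wf in auto)
  moreover have "\<Gamma> \<turnstile> Imp (Imp Q (Box (ODE ode Q) (Eq (lie ode p) 0)))
     (Iff (Box (ODE ode Q) (Eq p 0)) (Imp Q (Eq p 0)))"
    using assms wf by (intro derive_axiom0 axiom0.DI_Eq) auto
  ultimately have "\<Gamma> \<turnstile> Iff (Box (ODE ode Q) (Eq p 0)) (Imp Q (Eq p 0))"
    using derive_mp assms wf by auto
  then show ?thesis
    by (rule derive_IffD2) (use assms wf in auto)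
qed

lemma derive_V:
  assumes "\<Gamma> \<turnstile> \<phi>" "FV \<phi> \<inter> BV \<alpha> = {}" "wfs \<Gamma>" "wf_prog \<alpha>" "wf_fml \<phi>"
  shows "\<Gamma> \<turnstile> Box \<alpha> \<phi>"
  by (rule derive_mp[OF derive_axiom0[OF axiom0.V]]) (use assms in auto)


subsection \<open>Invariance of the common zeros of the Lie derivatives\<close>

text \<open>
  Rescaling \<open>e\<close> by the square of a ghost \<open>z\<close> with \<open>z' = - h z\<close> makes it non-increasing; the second
  ghost \<open>w' = h w\<close> keeps \<open>z w = 1\<close> and thus \<open>z\<close> away from 0.
\<close>

lemma derive_darboux:
  assumes ode: "distinct (map fst ode)" and Q: "fo Q" and \<Gamma>: "wfs \<Gamma>"
    and le: "\<And>\<nu>. teval (lie ode e) \<nu> \<le> 2 * teval h \<nu> * teval e \<nu>"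
    and init: "\<Gamma> \<turnstile> Imp Q (Geq (- e) 0)"
  shows "\<Gamma> \<turnstile> Box (ODE ode Q) (Geq (- e) 0)"
proof -
  \<comment> \<open>The free variables of \<open>\<Gamma>\<close> are avoided too, because the
    ghosts later serve as eigenvariables.\<close>
  let ?X = "ode_vars ode \<union> vars Q \<union> indets e \<union> indets h \<union> \<Union> (FV ` set \<Gamma>)"
  have "finite ?X"
    by (auto simp: finite_ode_vars finite_vars finite_FV)
  then obtain vs where vs: "length vs = 2" "distinct vs" "set vs \<inter> ?X = {}"
    by (rule fresh_list)
  then obtain z w where zw: "vs = [z, w]"
    by (metis (no_types, lifting) One_nat_def Suc_1 Suc_length_conv length_0_conv)
  have fresh: "z \<noteq> w" "z \<notin> ?X" "w \<notin> ?X"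
    using vs zw by auto
  \<comment> \<open>The matrix is diagonal with entries \<open>- h\<close> and \<open>h\<close>,
    which gives the two separate ghost equations.\<close>
  define a where "a i j = (if i \<noteq> j then 0 else if i = 0 then - h else h)" for i j :: nat
  define ode' where "ode' = ode @ ghosts vs a (\<lambda>_. 0)"
  have ghosts: "ghosts vs a (\<lambda>_. 0) = [(z, - h * Var z), (w, h * Var w)]"
    by (simp add: ghosts_def zw a_def upt_rec lessThan_Suc)
  have fst_ode: "fst ` set ode \<subseteq> ode_vars ode"
    by (force simp: ode_vars_def)
  have d: "distinct (map fst ode')"
    using ode fresh fst_ode by (auto simp: ode'_def ghosts)
  have lie_z: "teval (lie ode' (Var z)) \<nu> = - teval h \<nu> * \<nu> z"
    and lie_w: "teval (lie ode' (Var w)) \<nu> = teval h \<nu> * \<nu> w" for \<nu>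
    using teval_lie_Var[OF d, of z "- h * Var z"] teval_lie_Var[OF d, of w "h * Var w"]
    by (auto simp: ode'_def ghosts)
  have lie_e: "teval (lie ode' e) \<nu> = teval (lie ode e) \<nu>" for \<nu>
    using fresh by (auto simp: ode'_def teval_lie_append ghosts intro!: teval_lie_const)
  let ?init = "And (Eq (Var z) 1) (Eq (Var w) 1)"
  let ?\<alpha> = "ODE ode' Q"
  let ?\<Gamma> = "?init # \<Gamma>"
  have wf: "wf_prog ?\<alpha>" "wfs ?\<Gamma>" "wf_fml Q"
    using d Q \<Gamma> by (auto intro: fo_imp_wf)
  have init': "?\<Gamma> \<turnstile> ?init" "?\<Gamma> \<turnstile> Imp Q (Geq (- e) 0)"
    by (rule derive_assumption, use wf in auto) (rule derivable.Weaken[OF init], use wf in auto)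
  have zw1: "?\<Gamma> \<turnstile> Box ?\<alpha> (Eq (Var z * Var w - 1) 0)"
  proof (rule derive_DI_Eq)
    show "?\<Gamma> \<turnstile> Box ?\<alpha> (Eq (lie ode' (Var z * Var w - 1)) 0)"
      by (rule derive_box_arith[where \<Delta> = "[]"]) (use wf in \<open>auto simp: lie_z lie_w\<close>)
    show "?\<Gamma> \<turnstile> Imp Q (Eq (Var z * Var w - 1) 0)"
      by (rule derive_arith[where \<Delta> = "[?init]"]) (use wf init' Q in auto)
  qed (use wf in auto)
  have ez: "?\<Gamma> \<turnstile> Box ?\<alpha> (Geq (- (e * Var z ^ 2)) 0)"
  proof (rule derive_DI_Geq)
    show "?\<Gamma> \<turnstile> Box ?\<alpha> (Geq (lie ode' (- (e * Var z ^ 2))) 0)"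
    proof (rule derive_box_arith[where \<Delta> = "[]"])
      fix \<nu>
      have "0 \<le> (2 * teval h \<nu> * teval e \<nu> - teval (lie ode e) \<nu>) * (\<nu> z)\<^sup>2"
        using le[of \<nu>] by simp
      then show "sat (Geq (lie ode' (- (e * Var z ^ 2))) 0) \<nu>"
        by (simp add: lie_z lie_e algebra_simps power2_eq_square)
    qed (use wf in auto)
    \<comment> \<open>The factor \<open>z\<close> enters as a square, so multiplying by it preserves
      the initial sign condition.\<close>
    show "?\<Gamma> \<turnstile> Imp Q (Geq (- (e * Var z ^ 2)) 0)"
      by (rule derive_arith[where \<Delta> = "[Imp Q (Geq (- e) 0)]"])
         (use wf init' Q in \<open>auto simp: mult_nonpos_nonneg\<close>)
  qed (use wf in auto)
  have box: "?\<Gamma> \<turnstile> Box ?\<alpha> (Geq (- e) 0)"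
  proof (rule derive_box_arith[where \<Delta> = "[Eq (Var z * Var w - 1) 0, Geq (- (e * Var z ^ 2)) 0]"])
    fix \<nu>
    assume "\<forall>\<phi>\<in>set [Eq (Var z * Var w - 1) 0, Geq (- (e * Var z ^ 2)) 0]. sat \<phi> \<nu>"
    then have "\<nu> z \<noteq> 0" "teval e \<nu> * (\<nu> z)\<^sup>2 \<le> 0"
      by auto
    then show "sat (Geq (- e) 0) \<nu>"
      by (simp add: mult_le_0_iff)
  qed (use wf zw1 ez in auto)
  \<comment> \<open>Fresh variables can be given the initial value 1 by arithmetic alone. (DG), read
    from right to left, then removes the ghosts from the ODE.\<close>
  have "\<Gamma> \<turnstile> foldr Exists vs ?init"
  proof (rule derive_arith[where \<Delta> = "[]"])
    fix \<nu> :: state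
    show "sat (foldr Exists vs ?init) \<nu>"
      unfolding sat_foldr_Exists using fresh
      by (intro exI[of _ "\<nu>(z := 1, w := 1)"]) (auto simp: zw)
  qed (use \<Gamma> in auto)
  then have ex: "\<Gamma> \<turnstile> foldr Exists vs (Box ?\<alpha> (Geq (- e) 0))"
  proof (rule derivable.Cut)
    show "foldr Exists vs ?init # \<Gamma> \<turnstile> foldr Exists vs (Box ?\<alpha> (Geq (- e) 0))"
      by (intro derive_ExistsE derive_ExistsI box) (use fresh in \<open>auto simp: zw\<close>)
  qed
  have iff: "\<Gamma> \<turnstile> Iff (Box (ODE ode Q) (Geq (- e) 0)) (foldr Exists vs (Box ?\<alpha> (Geq (- e) 0)))"
    unfolding ode'_def
    by (intro derive_axiom0 axiom0.DG) (use vs fresh wf ode d \<Gamma> Q in \<open>auto simp: a_def zw ode'_def\<close>)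
  show ?thesis
    by (rule derive_IffD2[OF iff ex]) (use wf ode \<Gamma> Q in auto)
qed

section \<open>Sufficiency: a differential inequality for the sum of squares\<close>

lemma abs_le_one_plus_square: "\<bar>x::real\<bar> \<le> 1 + x\<^sup>2"
  using zero_le_power2[of "\<bar>x\<bar> - 1"] by (simp add: power2_diff)

text \<open>The cofactors have real coefficients, whereas right-hand sides of ghost equations are
  terms over the rationals. Rounding the absolute coefficients up and bounding each variable
  \<open>x\<close> by \<open>1 + x^2\<close> gives a rational majorant.\<close>

lemma rational_bound:
  fixes g :: "real mpoly"
  obtains h :: trm where "\<And>\<nu>. \<bar>real_coeff.ev g \<nu>\<bar> \<le> teval h \<nu>"
proof
  define c where "c m = nat \<lceil>\<bar>Poly_Mapping.lookup g m\<bar>\<rceil>" for m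
  let ?h = "\<Sum>m\<in>Poly_Mapping.keys g. of_nat (c m) *
    (\<Prod>x\<in>Poly_Mapping.keys m. (1 + Var x ^ 2) ^ Poly_Mapping.lookup m x)"
  show "\<bar>real_coeff.ev g \<nu>\<bar> \<le> teval ?h \<nu>" for \<nu>
  proof -
    have "\<bar>Poly_Mapping.lookup g m\<bar> \<le> of_nat (c m)" for m
      unfolding c_def by linarith
    then have "\<bar>Poly_Mapping.lookup g m * mon m \<nu>\<bar> \<le>
        of_nat (c m) * (\<Prod>x\<in>Poly_Mapping.keys m. (1 + (\<nu> x)\<^sup>2) ^ Poly_Mapping.lookup m x)" for m
      unfolding mon_def abs_mult abs_prod power_abs
      by (intro mult_mono prod_mono power_mono conjI)
         (auto simp: abs_le_one_plus_square intro!: prod_nonneg)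
    then show ?thesis
      unfolding real_coeff.ev_def by (auto intro!: order_trans[OF sum_abs] sum_mono)
  qed
qed

lemma derive_sufficiency:
  assumes ode: "distinct (map fst ode)" and Q: "fo Q" and N: "1 \<le> N" and dep: "lie_dependent ode p N"
  shows "[Imp Q (Conj (map (\<lambda>i. Eq ((lie ode ^^ i) p) 0) [0..<N]))] \<turnstile> Box (ODE ode Q) (Eq p 0)"
proof -
  let ?P = "\<lambda>i. (lie ode ^^ i) p"
  define e where "e = (\<Sum>i<N. ?P i ^ 2)"
  obtain g where g: "real_mpoly (?P N) = (\<Sum>i<N. g i * real_mpoly (?P i))"
    using dep unfolding lie_dependent_def by blast
  have "\<exists>h. \<forall>\<nu>. \<bar>real_coeff.ev (g i) \<nu>\<bar> \<le> teval h \<nu>" for i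
    using rational_bound[of "g i"] by blast
  then obtain h where h: "\<bar>real_coeff.ev (g i) \<nu>\<bar> \<le> teval (h i) \<nu>" for i \<nu>
    by metis
  \<comment> \<open>The Lie derivative of \<open>e\<close> is twice a sum of \<open>N\<close>
    products of consecutive Lie derivatives; \<open>H\<close> is \<open>N\<close> times the factor
    that bounds one such product by \<open>e\<close>.\<close>
  define H where "H = of_nat N * (1 + (\<Sum>j<N. h j))"
  have PN: "teval (?P N) \<nu> = (\<Sum>i<N. real_coeff.ev (g i) \<nu> * teval (?P i) \<nu>)" for \<nu>
    using arg_cong[OF g, of "\<lambda>q. real_coeff.ev q \<nu>"]
    by (simp add: real_coeff.ev_sum real_coeff.ev_mult ev_real_mpoly)
  have le: "teval (lie ode e) \<nu> \<le> 2 * teval H \<nu> * teval e \<nu>" for \<nu>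
  proof -
    let ?p = "\<lambda>i. teval (?P i) \<nu>" and ?E = "teval e \<nu>"
    have E: "?E = (\<Sum>i<N. (?p i)\<^sup>2)"
      by (simp add: e_def)
    then have E0: "0 \<le> ?E" by (simp add: sum_nonneg)
    have sq: "(?p i)\<^sup>2 \<le> ?E" if "i < N" for i
      unfolding E using that by (intro member_le_sum) auto
    have prod_le: "\<bar>?p i * ?p j\<bar> \<le> ?E" if "i < N" "j < N" for i j
    proof -
      have "2 * \<bar>?p i * ?p j\<bar> \<le> (?p i)\<^sup>2 + (?p j)\<^sup>2"
        using sum_squares_bound[of "\<bar>?p i\<bar>" "\<bar>?p j\<bar>"] by (simp add: abs_mult)
      then show ?thesis using sq[of i] sq[of j] that by linarith
    qed
    have h0: "0 \<le> teval (h j) \<nu>" for j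
      using h[of j \<nu>] by linarith
    then have S0: "0 \<le> (\<Sum>j<N. teval (h j) \<nu>)"
      by (simp add: sum_nonneg)
    \<comment> \<open>For \<open>Suc i < N\<close> both factors occur squared in \<open>e\<close>,
      which uses the summand 1 of the bound. For \<open>Suc i = N\<close> the rank identity replaces
      the last factor, which uses the \<open>h j\<close>.\<close>
    have step: "?p i * ?p (Suc i) \<le> (1 + (\<Sum>j<N. teval (h j) \<nu>)) * ?E" if "i < N" for i
    proof (cases "Suc i < N")
      case True
      have "?p i * ?p (Suc i) \<le> 1 * ?E"
        using prod_le[OF that True] by linarith
      also have "\<dots> \<le> (1 + (\<Sum>j<N. teval (h j) \<nu>)) * ?E"
        using S0 E0 by (intro mult_right_mono) auto
      finally show ?thesis .
    next
      case False
      then have "Suc i = N" using that by simp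
      then have "?p i * ?p (Suc i) = (\<Sum>j<N. real_coeff.ev (g j) \<nu> * (?p i * ?p j))"
        using PN[of \<nu>] by (simp add: sum_distrib_left mult_ac)
      also have "\<dots> \<le> (\<Sum>j<N. teval (h j) \<nu> * ?E)"
      proof (rule sum_mono)
        fix j assume "j \<in> {..<N}"
        then have "\<bar>real_coeff.ev (g j) \<nu> * (?p i * ?p j)\<bar> \<le> teval (h j) \<nu> * ?E"
          unfolding abs_mult[of "real_coeff.ev (g j) \<nu>"]
          using that h h0 by (intro mult_mono prod_le) auto
        then show "real_coeff.ev (g j) \<nu> * (?p i * ?p j) \<le> teval (h j) \<nu> * ?E"
          by linarith
      qed
      also have "\<dots> = (\<Sum>j<N. teval (h j) \<nu>) * ?E"
        by (simp add: sum_distrib_right)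
      also have "\<dots> \<le> (1 + (\<Sum>j<N. teval (h j) \<nu>)) * ?E"
        using E0 by (intro mult_right_mono) auto
      finally show ?thesis .
    qed
    have "teval (lie ode e) \<nu> = 2 * (\<Sum>i<N. ?p i * ?p (Suc i))"
      by (simp add: e_def sum_distrib_left mult_ac)
    also have "\<dots> \<le> 2 * (\<Sum>i<N. (1 + (\<Sum>j<N. teval (h j) \<nu>)) * ?E)"
      using step by (intro mult_left_mono sum_mono) auto
    also have "\<dots> = 2 * teval H \<nu> * ?E"
      by (simp add: H_def)
    finally show ?thesis .
  qed
  let ?hyp = "Imp Q (Conj (map (\<lambda>i. Eq (?P i) 0) [0..<N]))"
  have wf: "fo ?hyp" "wf_fml ?hyp"
    using Q by (auto intro!: fo_imp_wf)
  have "[?hyp] \<turnstile> Box (ODE ode Q) (Geq (- e) 0)"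
  proof (rule derive_darboux[OF ode Q _ le])
    show "[?hyp] \<turnstile> Imp Q (Geq (- e) 0)"
      by (rule derive_arith[where \<Delta> = "[?hyp]"])
         (use wf Q in \<open>auto simp: e_def intro!: derive_assumption\<close>)
  qed (use wf in auto)
  then show ?thesis
  proof (intro derive_box_arith[where \<Delta> = "[Geq (- e) 0]"])
    fix \<nu>
    assume "\<forall>\<phi>\<in>set [Geq (- e) 0]. sat \<phi> \<nu>"
    then have "teval e \<nu> \<le> 0" by auto
    \<comment> \<open>The polynomial \<open>p\<close> itself is the Lie derivative of order 0, and
      its square is a summand of \<open>e\<close> because \<open>N\<close> is at least 1.\<close>
    moreover have "(teval (?P 0) \<nu>)\<^sup>2 \<le> teval e \<nu>"
      unfolding e_def teval_sum teval_power using N by (intro member_le_sum) auto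
    ultimately show "sat (Eq p 0) \<nu>"
      by (simp add: order_antisym_conv)
         (metis order_trans power2_less_eq_zero_iff)
  qed (use ode Q wf in auto)
qed


subsection \<open>Local progress into the domain\<close>

text \<open>Restricting a state to \<open>X\<close> is continuous and does not affect the truth of
  \<open>Q\<close>, so the set is the preimage of the given open set.\<close>

lemma open_sat:
  assumes "fo Q" "FV Q \<subseteq> X" "openin (powertop_real X) {\<nu> \<in> extensional X. sat Q \<nu>}"
  shows "open {\<nu>. sat Q \<nu>}"
proof -
  have "continuous_map euclidean (powertop_real X) (\<lambda>\<nu> :: state. restrict \<nu> X)"
    unfolding continuous_map_componentwise
  proof (intro conjI ballI)
    show "continuous_map euclidean euclideanreal (\<lambda>\<nu> :: state. restrict \<nu> X k)" if "k \<in> X" for k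
      using that by (simp add: continuous_map_iff_continuous2)
  qed auto
  from openin_continuous_map_preimage[OF this assms(3)]
  have "open {\<nu> :: state. sat Q (restrict \<nu> X)}"
    by simp
  moreover have "sat Q (restrict \<nu> X) = sat Q \<nu>" for \<nu>
    using assms by (intro sat_coincidence) auto
  ultimately show ?thesis by simp
qed

text \<open>Only the finitely many coordinates in \<open>xs\<close> move, so the least of their
  interval radii in a basic neighbourhood suffices. A sum of squares measures the distance because a
  polynomial can express it.\<close>

lemma open_state_ball:
  fixes W :: "state set"
  assumes "open W" "\<nu> \<in> W"
  obtains \<rho> where "\<rho> > 0"
    "\<And>\<mu>. (\<Sum>i<length xs. (\<mu> (xs ! i) - \<nu> (xs ! i))\<^sup>2) < \<rho> \<Longrightarrow> (\<lambda>v. if v \<in> set xs then \<mu> v else \<nu> v) \<in> W"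
proof -
  obtain U where U: "\<And>v. open (U v)" "\<nu> \<in> Pi\<^sub>E UNIV U" "Pi\<^sub>E UNIV U \<subseteq> W"
    using assms(1,2) unfolding open_fun_def openin_product_topology_alt
    by (auto dest!: bspec[of _ _ \<nu>])
  have "\<exists>\<epsilon>>0. ball (\<nu> v) \<epsilon> \<subseteq> U v" for v
    using U(1)[of v] PiE_mem[OF U(2), of v] unfolding open_contains_ball by blast
  then obtain \<epsilon> where \<epsilon>: "\<epsilon> v > 0" "ball (\<nu> v) (\<epsilon> v) \<subseteq> U v" for v
    by metis
  \<comment> \<open>The inserted 1 keeps the minimum defined when \<open>xs\<close> is
    empty.\<close>
  define \<delta> where "\<delta> = Min (insert 1 (\<epsilon> ` set xs))"
  have \<delta>: "\<delta> > 0"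
    using \<epsilon> by (auto simp: \<delta>_def)
  show ?thesis
  proof (rule that[of "\<delta>\<^sup>2"])
    fix \<mu> :: state
    let ?\<mu> = "\<lambda>v. if v \<in> set xs then \<mu> v else \<nu> v"
    assume *: "(\<Sum>i<length xs. (\<mu> (xs ! i) - \<nu> (xs ! i))\<^sup>2) < \<delta>\<^sup>2"
    have "\<mu> v \<in> U v" if v: "v \<in> set xs" for v
    proof -
      obtain i where i: "i < length xs" "v = xs ! i"
        using v by (auto simp: in_set_conv_nth)
      have "(\<mu> v - \<nu> v)\<^sup>2 \<le> (\<Sum>i<length xs. (\<mu> (xs ! i) - \<nu> (xs ! i))\<^sup>2)"
        unfolding i(2) using i(1)
        by (intro member_le_sum[where f = "\<lambda>i. (\<mu> (xs ! i) - \<nu> (xs ! i))\<^sup>2"]) auto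
      with * have "\<bar>\<mu> v - \<nu> v\<bar>\<^sup>2 < \<delta>\<^sup>2"
        by simp
      then have "\<bar>\<mu> v - \<nu> v\<bar> < \<delta>"
        by (rule power2_less_imp_less) (use \<delta> in auto)
      also have "\<dots> \<le> \<epsilon> v"
        unfolding \<delta>_def using v by (intro Min_le) auto
      finally show ?thesis
        using \<epsilon>(2)[of v] by (auto simp: dist_real_def)
    qed
    then have "?\<mu> \<in> Pi\<^sub>E UNIV U"
      using U(2) by auto
    then show "?\<mu> \<in> W"
      using U(3) by blast
  qed (use \<delta> in auto)
qed

lemma ex_assignment:
  assumes "distinct vs" "length rs = length vs"
  shows "\<exists>\<mu>. (\<forall>x. x \<notin> set vs \<longrightarrow> \<mu> x = \<nu> x) \<and> map \<mu> vs = rs"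
  using assms
proof (induction vs arbitrary: rs)
  case (Cons v vs)
  then obtain q qs where rs: "rs = q # qs" "length qs = length vs"
    by (auto simp: length_Suc_conv)
  with Cons obtain \<mu> where \<mu>: "\<forall>x. x \<notin> set vs \<longrightarrow> \<mu> x = \<nu> x" "map \<mu> vs = qs"
    by force
  then show ?case
    using Cons.prems rs by (intro exI[of _ "\<mu>(v := q)"]) auto
qed auto

text \<open>
  The clock \<open>t\<close> is what (Cont) requires. The variables \<open>ys, t0\<close> are the copies of the initial state
  in (Cont); the further copy \<open>zs\<close> is the centre of the ball, whose polynomial must not mention \<open>ys\<close>.
  The chain \<open>u\<close> stands for the Lie derivatives of \<open>p\<close> or of \<open>- p\<close>.
\<close>

locale progress =
  fixes xs :: "nat list" and fs :: "trm list" and Q :: fml and u :: "nat \<Rightarrow> trm" and i :: nat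
    and t t0 r :: nat and ys zs :: "nat list"
  assumes fs: "length fs = length xs" "\<forall>e\<in>set fs. indets e \<subseteq> set xs"
    and Q: "fo Q" "FV Q \<subseteq> set xs" "openin (powertop_real (set xs)) {\<nu> \<in> extensional (set xs). sat Q \<nu>}"
    and u: "indets (u k) \<subseteq> set xs" "teval (lie (zip xs fs) (u k)) \<nu> = teval (u (Suc k)) \<nu>"
    and fresh: "distinct (xs @ t # ys @ t0 # zs @ [r])"
    and len: "length ys = length xs" "length zs = length xs"
begin

definition "ode = zip xs fs @ [(t, 1)]"
definition "dist2 = (\<Sum>j<length xs. (Var (xs ! j) - Var (zs ! j)) ^ 2)"
definition "speed = (\<Sum>j<length xs. 2 * (Var (xs ! j) - Var (zs ! j)) * fs ! j)"
text \<open>The variable \<open>r\<close> has three roles: squared radius of the ball, lower bound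
  for \<open>u i\<close> on it, and reciprocal of a bound on \<open>speed\<close>. One variable is
  enough because all three conditions persist when it shrinks.\<close>

definition "near = Gt (Var r - dist2) 0"
text \<open>Quantifying over \<open>xs\<close> leaves only \<open>r\<close> and \<open>zs\<close>
  free. As these do not evolve, (V) carries the bounds along the flow.\<close>

definition "local_bounds = foldr Forall xs
  (Imp near (And Q (And (Geq (u i) (Var r)) (Geq 1 (Var r * speed)))))"
definition "rigid = And (EqV zs ys) (And (Gt (Var r) 0) local_bounds)"
definition "start = EqV (xs @ [t]) (ys @ [t0])"
text \<open>In the domain, \<open>u 0\<close> has a zero of order exactly \<open>i\<close> along the
  flow, with positive leading derivative; \<open>i = 0\<close> means that it is positive.\<close>

definition "order_i = And Q (And (Conj (map (\<lambda>k. Eq (u k) 0) [0..<i])) (Gt (u i) 0))"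

lemma fst_ode: "map fst ode = xs @ [t]"
  using fs by (simp add: ode_def)

lemma fst_ode_set: "fst ` set ode = insert t (set xs)"
  using arg_cong[OF fst_ode, of set] by auto

lemma distinct_ode: "distinct (map fst ode)"
  using fresh by (auto simp: fst_ode)

lemma ode_vars_ode: "ode_vars ode = insert t (set xs)"
proof -
  have "insert x (indets e) \<subseteq> insert t (set xs)" if "(x, e) \<in> set ode" for x e
    using that fs by (auto simp: ode_def dest: set_zip_leftD set_zip_rightD)
  then have "ode_vars ode \<subseteq> insert t (set xs)"
    by (auto simp: ode_vars_def)
  moreover have "insert t (set xs) \<subseteq> ode_vars ode"
    unfolding fst_ode_set[symmetric] by (force simp: ode_vars_def)
  ultimately show ?thesis
    by (rule subset_antisym)
qed

lemma nth_fresh: "j < length xs \<Longrightarrow> zs ! j \<notin> insert t (set xs)" "r \<notin> insert t (set xs)" "t0 \<notin> insert t (set xs)"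
  using fresh len by (auto dest!: nth_mem[of j zs])

lemma lie_t: "teval (lie ode (Var t)) \<nu> = 1"
  using teval_lie_Var[OF distinct_ode, of t 1] by (simp add: ode_def)

lemma lie_xs: "j < length xs \<Longrightarrow> teval (lie ode (Var (xs ! j))) \<nu> = teval (fs ! j) \<nu>"
  using fs by (intro teval_lie_Var[OF distinct_ode]) (auto simp: ode_def set_zip)

lemma lie_const: "v \<notin> insert t (set xs) \<Longrightarrow> teval (lie ode (Var v)) \<nu> = 0"
  by (rule teval_lie_const) (simp add: fst_ode_set)

lemma lie_rigid:
  "j < length xs \<Longrightarrow> teval (lie ode (Var (zs ! j))) \<nu> = 0"
  "teval (lie ode (Var r)) \<nu> = 0" "teval (lie ode (Var t0)) \<nu> = 0"
  by (rule lie_const, erule nth_fresh(1)) (rule lie_const, rule nth_fresh)+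

lemma indets_fs: "j < length xs \<Longrightarrow> indets (fs ! j) \<subseteq> set xs"
  using fs by auto

lemma lie_u: "teval (lie ode (u k)) \<nu> = teval (u (Suc k)) \<nu>"
proof -
  have "teval (lie [(t, 1)] (u k)) \<nu> = 0"
    using u(1)[of k] fresh by (intro teval_lie_const) auto
  then show ?thesis
    using u(2) by (simp add: ode_def teval_lie_append)
qed

lemma lie_dist2: "teval (lie ode dist2) \<nu> = teval speed \<nu>"
  by (simp add: dist2_def speed_def lie_xs lie_rigid)

lemma fo_formulas: "fo near" "fo local_bounds" "fo rigid" "fo start" "fo order_i"
  using Q by (auto simp: near_def local_bounds_def rigid_def start_def order_i_def)

lemma indets_dist2: "indets dist2 \<subseteq> set xs \<union> set zs"
  unfolding dist2_def using len by (intro indets_subset_intros) auto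

lemma indets_speed: "indets speed \<subseteq> set xs \<union> set zs"
  unfolding speed_def using len fs by (intro indets_subset_intros) (auto dest: subsetD[OF indets_fs])

lemma FV_rigid: "FV rigid \<inter> insert t (set xs) = {}"
proof -
  have "indets (Var r - dist2) \<subseteq> insert r (set xs \<union> set zs)"
    "indets (Var r * speed) \<subseteq> insert r (set xs \<union> set zs)"
    using indets_dist2 indets_speed by (intro indets_diff_subset indets_mult_subset; auto)+
  then have "FV rigid \<subseteq> insert r (set zs \<union> set ys)"
    using FV_EqV[of zs ys] Q(2) u(1)[of i] by (auto simp: rigid_def local_bounds_def near_def)
  then show ?thesis
    using fresh by auto
qed

lemma FV_order_i: "FV order_i \<subseteq> set xs"
  using Q u(1) by (auto simp: order_i_def)

lemma sat_near: "sat near \<nu> \<longleftrightarrow> (\<Sum>j<length xs. (\<nu> (xs ! j) - \<nu> (zs ! j))\<^sup>2) < \<nu> r"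
  by (simp add: near_def dist2_def)

lemma sat_rigidD:
  assumes "sat rigid \<nu>"
  shows "\<nu> r > 0" "\<forall>j<length xs. \<nu> (zs ! j) = \<nu> (ys ! j)"
    "sat near \<nu> \<Longrightarrow> sat Q \<nu>" "sat near \<nu> \<Longrightarrow> teval (u i) \<nu> \<ge> \<nu> r"
    "sat near \<nu> \<Longrightarrow> \<nu> r * teval speed \<nu> \<le> 1"
  using assms len by (auto simp: rigid_def local_bounds_def sat_EqV sat_foldr_Forall)

lemma sat_order_iD: "sat order_i \<nu> \<Longrightarrow> k < i \<Longrightarrow> teval (u k) \<nu> = 0"
  by (simp add: order_i_def)

lemma sat_start: "sat start \<nu> \<longleftrightarrow> \<nu> t = \<nu> t0 \<and> (\<forall>j<length xs. \<nu> (xs ! j) = \<nu> (ys ! j))"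
  using len by (auto simp: start_def sat_EqV nth_append less_Suc_eq)

lemma sat_near_start:
  assumes "sat rigid \<nu>" "sat start \<nu>"
  shows "teval dist2 \<nu> = 0" "sat near \<nu>" "\<nu> t = \<nu> t0"
  using sat_rigidD[OF assms(1)] assms(2) by (simp_all add: sat_near dist2_def sat_start)

text \<open>All three conditions are open by continuity and hold at the centre; a small enough
  radius then also serves as the numerical bound.\<close>

lemma ex_local_radius:
  assumes "sat Q \<nu>" "teval (u i) \<nu> > 0"
  obtains \<rho> where "\<rho> > 0"
    "\<And>\<mu>. (\<Sum>j<length xs. (\<mu> (xs ! j) - \<nu> (xs ! j))\<^sup>2) < \<rho> \<Longrightarrow>
      sat Q \<mu> \<and> teval (u i) \<mu> \<ge> \<rho> \<and>
      \<rho> * (\<Sum>j<length xs. 2 * (\<mu> (xs ! j) - \<nu> (xs ! j)) * teval (fs ! j) \<mu>) \<le> 1"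
proof -
  define S where "S \<mu> = (\<Sum>j<length xs. 2 * (\<mu> (xs ! j) - \<nu> (xs ! j)) * teval (fs ! j) \<mu>)" for \<mu> :: state
  define W where "W = {\<mu>. sat Q \<mu>} \<inter> {\<mu>. teval (u i) \<mu> > teval (u i) \<nu> / 2} \<inter> {\<mu>. S \<mu> < 1}"
  have "continuous_on UNIV S"
    unfolding S_def
    by (intro continuous_intros continuous_on_product_coordinates continuous_on_teval)
  then have "open W"
    unfolding W_def
    by (intro open_Int open_sat[OF Q] open_Collect_less continuous_on_teval continuous_on_const)
  moreover have "\<nu> \<in> W"
    using assms by (simp add: W_def S_def)
  ultimately obtain \<rho> where \<rho>: "\<rho> > 0"
    "\<And>\<mu>. (\<Sum>j<length xs. (\<mu> (xs ! j) - \<nu> (xs ! j))\<^sup>2) < \<rho> \<Longrightarrow> (\<lambda>v. if v \<in> set xs then \<mu> v else \<nu> v) \<in> W"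
    by (rule open_state_ball) blast
  \<comment> \<open>The bound 1 on the factor makes \<open>?\<rho> * S \<mu> \<le> 1\<close> follow
    from \<open>S \<mu> < 1\<close>; half of the central value of \<open>u i\<close> makes the
    radius a lower bound for \<open>u i\<close>.\<close>
  let ?\<rho> = "min \<rho> (min 1 (teval (u i) \<nu> / 2))"
  show ?thesis
  proof (rule that[of ?\<rho>])
    show "?\<rho> > 0" using \<rho>(1) assms(2) by simp
    fix \<mu> :: state
    assume "(\<Sum>j<length xs. (\<mu> (xs ! j) - \<nu> (xs ! j))\<^sup>2) < ?\<rho>"
    then have *: "(\<lambda>v. if v \<in> set xs then \<mu> v else \<nu> v) \<in> W" (is "?\<mu> \<in> W")
      using \<rho>(2) by simp
    have "sat Q ?\<mu> = sat Q \<mu>"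
      using Q by (intro sat_coincidence) auto
    moreover have "teval (u i) ?\<mu> = teval (u i) \<mu>"
      using u(1)[of i] by (intro teval_coincidence) auto
    moreover have "S ?\<mu> = S \<mu>"
    proof -
      have "teval (fs ! j) ?\<mu> = teval (fs ! j) \<mu>" if "j < length xs" for j
        using indets_fs[OF that] by (intro teval_coincidence) auto
      then show ?thesis
        by (simp add: S_def)
    qed
    ultimately have "sat Q \<mu>" "teval (u i) \<mu> > teval (u i) \<nu> / 2" "S \<mu> < 1"
      using * by (auto simp: W_def)
    moreover have "?\<rho> * S \<mu> \<le> 1"
    proof (cases "S \<mu> \<le> 0")
      case True
      then have "?\<rho> * S \<mu> \<le> 0"
        using \<open>?\<rho> > 0\<close> by (simp add: mult_nonneg_nonpos)
      then show ?thesis by linarith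
    next
      case False
      have "?\<rho> * S \<mu> \<le> 1 * 1"
        using False \<open>?\<rho> > 0\<close> \<open>S \<mu> < 1\<close> by (intro mult_mono) auto
      then show ?thesis by simp
    qed
    ultimately show "sat Q \<mu> \<and> teval (u i) \<mu> \<ge> ?\<rho> \<and>
        ?\<rho> * (\<Sum>j<length xs. 2 * (\<mu> (xs ! j) - \<nu> (xs ! j)) * teval (fs ! j) \<mu>) \<le> 1"
      by (auto simp: S_def)
  qed
qed

lemma sat_ex_bounds:
  assumes "sat order_i \<nu>"
  shows "sat (foldr Exists (ys @ t0 # zs @ [r]) (And rigid start)) \<nu>"
proof -
  have "sat Q \<nu>" "teval (u i) \<nu> > 0"
    using assms by (auto simp: order_i_def)
  then obtain \<rho> where \<rho>: "\<rho> > 0"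
    "\<And>\<mu>. (\<Sum>j<length xs. (\<mu> (xs ! j) - \<nu> (xs ! j))\<^sup>2) < \<rho> \<Longrightarrow>
      sat Q \<mu> \<and> teval (u i) \<mu> \<ge> \<rho> \<and>
      \<rho> * (\<Sum>j<length xs. 2 * (\<mu> (xs ! j) - \<nu> (xs ! j)) * teval (fs ! j) \<mu>) \<le> 1"
    by (rule ex_local_radius) blast
  let ?vs = "ys @ t0 # zs @ [r]"
  have "\<exists>\<mu>. (\<forall>x. x \<notin> set ?vs \<longrightarrow> \<mu> x = \<nu> x) \<and> map \<mu> ?vs = map \<nu> xs @ \<nu> t # map \<nu> xs @ [\<rho>]"
    using fresh len by (intro ex_assignment) auto
  then obtain \<mu> where \<mu>: "\<And>x. x \<notin> set ?vs \<Longrightarrow> \<mu> x = \<nu> x"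
    and "map \<mu> ?vs = map \<nu> xs @ \<nu> t # map \<nu> xs @ [\<rho>]"
    by blast
  then have copies: "map \<mu> ys = map \<nu> xs" "\<mu> t0 = \<nu> t" "map \<mu> zs = map \<nu> xs" "\<mu> r = \<rho>"
    using len by (auto simp: append_eq_append_conv)
  have ys: "\<mu> (ys ! j) = \<nu> (xs ! j)" and zs: "\<mu> (zs ! j) = \<nu> (xs ! j)" if "j < length xs" for j
    using arg_cong[OF copies(1), of "\<lambda>l. l ! j"] arg_cong[OF copies(3), of "\<lambda>l. l ! j"] that len
    by auto
  have old: "\<mu> v = \<nu> v" if "v \<in> insert t (set xs)" for v
    using that fresh by (intro \<mu>) auto
  have "sat start \<mu>"
    using ys old copies(2) by (auto simp: sat_start)
  moreover have "sat rigid \<mu>"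
  proof -
    \<comment> \<open>The states \<open>\<kappa>\<close> covered by the quantifiers over
      \<open>xs\<close> agree with \<open>\<mu>\<close> elsewhere, so \<open>r\<close> and
      \<open>zs\<close> still hold the radius and the centre.\<close>
    have "sat (And Q (And (Geq (u i) (Var r)) (Geq 1 (Var r * speed)))) \<kappa>"
      if \<kappa>: "\<And>x. x \<notin> set xs \<Longrightarrow> \<kappa> x = \<mu> x" and "sat near \<kappa>" for \<kappa>
    proof -
      have "\<kappa> r = \<rho>" "\<And>j. j < length xs \<Longrightarrow> \<kappa> (zs ! j) = \<nu> (xs ! j)"
        using \<kappa> nth_fresh zs copies(4) by auto
      then show ?thesis
        using \<rho>(2)[of \<kappa>] \<open>sat near \<kappa>\<close> by (auto simp: sat_near speed_def)
    qed
    then show ?thesis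
      using \<rho>(1) copies(4) ys zs len
      by (auto simp: rigid_def local_bounds_def sat_EqV sat_foldr_Forall)
  qed
  ultimately show ?thesis
    unfolding sat_foldr_Exists using \<mu> by (intro exI[of _ \<mu>]) auto
qed

text \<open>
  While the ball is not left, \<open>u 0\<close> is at least \<open>r (t - t0) ^ i / fact i\<close> and the squared distance
  from the start is at most \<open>(t - t0) / r\<close>. So where \<open>u 0 = 0\<close> no time has passed and the state
  is still the initial one, although (Cont) says that it can be left within the ball.
\<close>

definition "taylor k = fact (i - k) * u k - Var r * (Var t - Var t0) ^ (i - k)"

text \<open>The factorial normalisation makes differentiation map each \<open>taylor k\<close> to a
  non-negative multiple of the next, so non-negativity propagates from \<open>k = i\<close> down to
  0.\<close>

lemma lie_taylor:
  assumes "k < i"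
  shows "teval (lie ode (taylor k)) \<nu> = of_nat (i - k) * teval (taylor (Suc k)) \<nu>"
proof -
  obtain m where m: "i - k = Suc m" "i - Suc k = m"
    using assms by (metis Suc_diff_Suc)
  show ?thesis
    unfolding taylor_def m by (simp del: power_Suc add: lie_u lie_t lie_rigid algebra_simps)
qed

lemma contradiction:
  "[Box (ODE ode Q) (Eq (u 0) 0), order_i] \<turnstile> FF"
proof -
  let ?\<Gamma> = "[Box (ODE ode Q) (Eq (u 0) 0), order_i]"
  let ?\<Gamma>' = "And rigid start # ?\<Gamma>" and ?\<alpha> = "ODE ode near"
  note fo = fo_formulas Q(1)
  have wf: "wfs ?\<Gamma>" "wfs ?\<Gamma>'" "wf_prog ?\<alpha>" "wf_prog (ODE ode Q)"
    using distinct_ode fo by (auto intro: fo_imp_wf)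
  have wf': "wf_fml start" "wf_fml near" "wf_fml rigid" "wf_fml Q"
    using fo by (auto intro: fo_imp_wf)
  have hyp: "?\<Gamma>' \<turnstile> And rigid start" "?\<Gamma>' \<turnstile> order_i" "?\<Gamma>' \<turnstile> Box (ODE ode Q) (Eq (u 0) 0)"
    using wf by (auto intro!: derive_assumption)
  have rigid0: "?\<Gamma>' \<turnstile> rigid" and start0: "?\<Gamma>' \<turnstile> start"
    by (rule derive_arith[where \<Delta> = "[And rigid start]"]; use wf hyp fo in auto)+
  have near0: "?\<Gamma>' \<turnstile> near"
    by (rule derive_arith[where \<Delta> = "[rigid, start]"])
       (use wf rigid0 start0 fo in \<open>auto simp: sat_near_start\<close>)
  have box_near: "?\<Gamma>' \<turnstile> Box ?\<alpha> near"
    using wf wf' by (intro derive_axiom0 axiom0.DW) auto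
  have box_rigid: "?\<Gamma>' \<turnstile> Box ?\<alpha> rigid"
    using wf wf' FV_rigid by (intro derive_V rigid0) (auto simp: fst_ode_set)
  \<comment> \<open>The ball lies in the domain, so (DMP) transfers the hypothesis from domain
    \<open>Q\<close> to domain \<open>near\<close>.\<close>
  have box_u: "?\<Gamma>' \<turnstile> Box ?\<alpha> (Eq (u 0) 0)"
  proof -
    have "?\<Gamma>' \<turnstile> Box ?\<alpha> (Imp near Q)"
      by (rule derive_box_arith[where \<Delta> = "[rigid]"])
         (use wf box_rigid fo in \<open>auto simp: sat_rigidD\<close>)
    moreover have "?\<Gamma>' \<turnstile> Imp (Box ?\<alpha> (Imp near Q))
        (Imp (Box (ODE ode Q) (Eq (u 0) 0)) (Box ?\<alpha> (Eq (u 0) 0)))"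
      using wf wf' by (intro derive_axiom0 axiom0.DMP) auto
    ultimately have "?\<Gamma>' \<turnstile> Imp (Box (ODE ode Q) (Eq (u 0) 0)) (Box ?\<alpha> (Eq (u 0) 0))"
      using derive_mp wf by auto
    then show ?thesis
      by (rule derive_mp) (use hyp wf in auto)
  qed
  \<comment> \<open>The Lie derivative is \<open>1 - r * speed\<close>, which is non-negative within
    the ball.\<close>
  have box_dist: "?\<Gamma>' \<turnstile> Box ?\<alpha> (Geq (Var t - Var t0 - Var r * dist2) 0)"
  proof (rule derive_DI_Geq)
    show "?\<Gamma>' \<turnstile> Box ?\<alpha> (Geq (lie ode (Var t - Var t0 - Var r * dist2)) 0)"
      by (rule derive_box_arith[where \<Delta> = "[rigid, near]"])
         (use wf box_rigid box_near fo in
          \<open>auto simp: lie_t lie_rigid lie_dist2 sat_rigidD\<close>)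
    show "?\<Gamma>' \<turnstile> Imp near (Geq (Var t - Var t0 - Var r * dist2) 0)"
      by (rule derive_arith[where \<Delta> = "[rigid, start]"])
         (use wf rigid0 start0 fo in \<open>auto simp: sat_near_start\<close>)
  qed (use wf in auto)
  \<comment> \<open>At \<open>k = i\<close> this is the bound \<open>u i \<ge> r\<close>. For
    smaller \<open>k\<close> the initial value is 0: \<open>u k\<close> vanishes, and the power of
    \<open>t - t0\<close> has a positive exponent.\<close>
  have box_taylor: "?\<Gamma>' \<turnstile> Box ?\<alpha> (Geq (taylor k) 0)" if "k \<le> i" for k
    using that
  proof (induction k rule: inc_induct)
    case base
    show ?case
      by (rule derive_box_arith[where \<Delta> = "[rigid, near]"])
         (use wf box_rigid box_near fo in \<open>auto simp: taylor_def sat_rigidD\<close>)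
  next
    case (step k)
    show ?case
    proof (rule derive_DI_Geq)
      show "?\<Gamma>' \<turnstile> Box ?\<alpha> (Geq (lie ode (taylor k)) 0)"
        by (rule derive_box_arith[where \<Delta> = "[Geq (taylor (Suc k)) 0]"])
           (use wf step in \<open>auto simp: lie_taylor\<close>)
      show "?\<Gamma>' \<turnstile> Imp near (Geq (taylor k) 0)"
        by (rule derive_arith[where \<Delta> = "[start, order_i]"])
           (use wf start0 hyp fo step in \<open>auto simp: taylor_def sat_start[THEN iffD1, THEN conjunct1] sat_order_iD power_0_left\<close>)
    qed (use wf in auto)
  qed
  \<comment> \<open>With \<open>u 0 = 0\<close>, \<open>taylor 0\<close> forces the elapsed time to
    be 0, and then \<open>box_dist\<close> forces the distance to be 0. The double negation is the
    form that the diamond axiom needs for \<open>Neg start\<close>.\<close>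
  have box_start: "?\<Gamma>' \<turnstile> Box ?\<alpha> (Neg (Neg start))"
  proof (rule derive_box_arith)
    let ?\<Delta> = "[rigid, Eq (u 0) 0, Geq (Var t - Var t0 - Var r * dist2) 0, Geq (taylor 0) 0]"
    show "\<forall>\<phi>\<in>set ?\<Delta>. ?\<Gamma>' \<turnstile> Box ?\<alpha> \<phi>"
      using box_rigid box_u box_dist box_taylor[of 0] by simp
    fix \<nu>
    assume sat: "\<forall>\<phi>\<in>set ?\<Delta>. sat \<phi> \<nu>"
    let ?s = "\<nu> t - \<nu> t0" and ?d = "\<Sum>j<length xs. (\<nu> (xs ! j) - \<nu> (zs ! j))\<^sup>2"
    have rigid: "sat rigid \<nu>" and u0: "teval (u 0) \<nu> = 0" and dist: "\<nu> r * ?d \<le> ?s"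
      and taylor: "\<nu> r * ?s ^ i \<le> fact i * teval (u 0) \<nu>"
      using sat by (auto simp: dist2_def taylor_def)
    have r: "\<nu> r > 0" "?d \<ge> 0"
      using sat_rigidD[OF rigid] by (auto intro: sum_nonneg)
    then have "0 \<le> \<nu> r * ?d"
      by simp
    with dist have "?s \<ge> 0"
      by linarith
    moreover have "?s ^ i \<le> 0"
      using taylor u0 r by (simp add: mult_le_0_iff)
    ultimately have "?s = 0"
      by (metis less_eq_real_def not_less zero_less_power)
    with dist r have "?d = 0"
      by (simp add: mult_le_0_iff)
    then have "\<forall>j<length xs. \<nu> (xs ! j) = \<nu> (zs ! j)"
      by (simp add: sum_nonneg_eq_0_iff)
    then show "sat (Neg (Neg start)) \<nu>"
      using \<open>?s = 0\<close> sat_rigidD(2)[OF rigid] by (simp add: sat_start)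
  qed (use wf fo in auto)
  \<comment> \<open>(Cont) is used with the polynomial \<open>Var r - dist2\<close>, whose
    positivity domain is the ball.\<close>
  have "?\<Gamma>' \<turnstile> Imp start (Imp near (Dia ?\<alpha> (Neg start)))"
    unfolding start_def near_def
  proof (intro derive_axiom1 axiom1.Cont)
    show "xs @ [t] = map fst ode" "1 \<in> snd ` set ode"
      by (simp_all add: fst_ode) (simp add: ode_def)
    have "indets (Var r - dist2) \<subseteq> insert r (set xs \<union> set zs)"
      using indets_dist2 by (intro indets_diff_subset) auto
    then show "set (ys @ [t0]) \<inter> (ode_vars ode \<union> indets (Var r - dist2)) = {}"
      using fresh by (auto simp: ode_vars_ode)
  qed (use fresh len wf wf' in \<open>auto simp: start_def near_def\<close>)
  then have "?\<Gamma>' \<turnstile> Imp near (Dia ?\<alpha> (Neg start))"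
    using derive_mp start0 wf wf' by auto
  then have dia: "?\<Gamma>' \<turnstile> Dia ?\<alpha> (Neg start)"
    using derive_mp near0 wf wf' by auto
  have iff: "?\<Gamma>' \<turnstile> Iff (Dia ?\<alpha> (Neg start)) (Neg (Box ?\<alpha> (Neg (Neg start))))"
    using wf wf' by (intro derive_axiom0 axiom0.Diamond) auto
  have "?\<Gamma>' \<turnstile> Neg (Box ?\<alpha> (Neg (Neg start)))"
    by (rule derive_IffD1[OF iff dia]) (use wf wf' in auto)
  then have FF: "?\<Gamma>' \<turnstile> FF"
    using box_start by (rule derive_NegD)
  \<comment> \<open>The copies and the radius occur neither in the hypotheses nor in
    \<open>FF\<close>; it remains that suitable values exist, which is arithmetic under
    \<open>order_i\<close>.\<close>
  have "?\<Gamma> \<turnstile> foldr Exists (ys @ t0 # zs @ [r]) (And rigid start)"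
    by (rule derive_arith[where \<Delta> = "[order_i]"])
       (use wf fo sat_ex_bounds in \<open>auto intro!: derive_assumption simp del: foldr_append foldr.simps\<close>)
  moreover have "foldr Exists (ys @ t0 # zs @ [r]) (And rigid start) # ?\<Gamma> \<turnstile> FF"
  proof (rule derive_ExistsE[OF FF])
    have "\<Union> (FV ` set ?\<Gamma>) \<subseteq> insert t (set xs)"
      using FV_order_i Q u(1)[of 0] by (auto simp: ode_vars_ode)
    then show "set (ys @ t0 # zs @ [r]) \<inter> (\<Union> (FV ` set ?\<Gamma>) \<union> FV FF) = {}"
      using fresh by auto
  qed
  ultimately show ?thesis
    by (rule derivable.Cut)
qed

end


section \<open>Necessity by induction on the order, and the equivalence\<close>

lemma derive_necessity:
  assumes xs: "distinct xs" "length fs = length xs" "\<forall>e\<in>set fs. indets e \<subseteq> set xs"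
    and p: "indets p \<subseteq> set xs"
    and Q: "fo Q" "FV Q \<subseteq> set xs" "openin (powertop_real (set xs)) {\<nu> \<in> extensional (set xs). sat Q \<nu>}"
  shows "[Q, Box (ODE (zip xs fs) Q) (Eq p 0)] \<turnstile>
    Conj (map (\<lambda>i. Eq ((lie (zip xs fs) ^^ i) p) 0) [0..<N])"
proof -
  let ?ode = "zip xs fs"
  let ?P = "\<lambda>i. (lie ?ode ^^ i) p"
  have ode_vars: "ode_vars ?ode \<subseteq> set xs"
    using xs(3) by (force simp: ode_vars_def dest: set_zip_leftD set_zip_rightD)
  have indets: "indets (?P i) \<subseteq> set xs" for i
    using xs(3) by (intro indets_lie_funpow p) (fastforce dest: set_zip_rightD)
  let ?X = "set xs \<union> vars Q"
  have X: "finite ?X"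
    by (simp add: finite_vars)
  then obtain vs where vs: "length vs = 3" "distinct vs" "set vs \<inter> ?X = {}"
    by (rule fresh_list)
  then obtain t t0 r where vs_eq: "vs = [t, t0, r]"
    by (auto simp: numeral_3_eq_3 length_Suc_conv)
  obtain ys where ys: "length ys = length xs" "distinct ys" "set ys \<inter> (?X \<union> set vs) = {}"
    using fresh_list[of "?X \<union> set vs" "length xs"] X by auto
  obtain zs where zs: "length zs = length xs" "distinct zs" "set zs \<inter> (?X \<union> set vs \<union> set ys) = {}"
    using fresh_list[of "?X \<union> set vs \<union> set ys" "length xs"] X by auto
  have fresh: "distinct (xs @ t # ys @ t0 # zs @ [r])" "t \<notin> ?X"
    using xs(1) vs ys zs unfolding vs_eq by auto
  let ?odet = "?ode @ [(t, 1)]"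
  let ?\<Gamma> = "[Box (ODE ?odet Q) (Eq p 0), Q]"
  have dist: "distinct (map fst ?ode)" "distinct (map fst ?odet)"
    using xs fresh by auto
  have wf: "wfs ?\<Gamma>" "wf_fml Q"
    using Q dist by (auto intro: fo_imp_wf)
  have hyp: "?\<Gamma> \<turnstile> Box (ODE ?odet Q) (Eq p 0)" "?\<Gamma> \<turnstile> Q"
    by (rule derive_assumption; use wf in auto)+
  \<comment> \<open>Stating this for an arbitrary chain \<open>u\<close> covers both signs of the
    Lie derivatives of \<open>p\<close>.\<close>
  have not_pos: "?\<Gamma> \<turnstile> Neg (Gt (u i) 0)"
    if u: "\<And>k. indets (u k) \<subseteq> set xs"
      "\<And>k \<nu>. teval (lie ?ode (u k)) \<nu> = teval (u (Suc k)) \<nu>"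
      and box: "?\<Gamma> \<turnstile> Box (ODE ?odet Q) (Eq (u 0) 0)"
      and lower: "\<And>k. k < i \<Longrightarrow> ?\<Gamma> \<turnstile> Eq (u k) 0" for u i
  proof (rule derivable.NegR)
    interpret progress xs fs Q u i t t0 r ys zs
      by unfold_locales (use xs Q u fresh ys zs in auto)
    let ?\<Gamma>' = "Gt (u i) 0 # ?\<Gamma>"
    have wf': "wfs ?\<Gamma>'" "wfs [Box (ODE ode Q) (Eq (u 0) 0), order_i]"
      using wf Q distinct_ode fo_formulas(5) by (auto intro: fo_imp_wf)
    show "?\<Gamma>' \<turnstile> FF"
    proof (rule derive_cuts[OF contradiction])
      have "?\<Gamma>' \<turnstile> Box (ODE ode Q) (Eq (u 0) 0)"
        unfolding ode_def by (rule derivable.Weaken[OF box]) (use wf' in auto)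
      moreover have "?\<Gamma>' \<turnstile> order_i"
      proof (rule derive_arith[where \<Delta> = "Gt (u i) 0 # Q # map (\<lambda>k. Eq (u k) 0) [0..<i]"])
        show "\<forall>\<phi>\<in>set (Gt (u i) 0 # Q # map (\<lambda>k. Eq (u k) 0) [0..<i]). ?\<Gamma>' \<turnstile> \<phi>"
        proof -
          have "?\<Gamma>' \<turnstile> Gt (u i) 0" "?\<Gamma>' \<turnstile> Q"
            by (rule derive_assumption; use wf' in auto)+
          moreover have "?\<Gamma>' \<turnstile> Eq (u k) 0" if "k < i" for k
            by (rule derivable.Weaken[OF lower[OF that]]) (use wf' in auto)
          ultimately show ?thesis by auto
        qed
      qed (use wf' fo_formulas(5) Q in \<open>auto simp: order_i_def\<close>)
      ultimately show "\<forall>\<phi>\<in>set [Box (ODE ode Q) (Eq (u 0) 0), order_i]. ?\<Gamma>' \<turnstile> \<phi>"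
        by simp
    qed (use wf' in \<open>auto intro: fo_imp_wf\<close>)
  qed
  \<comment> \<open>Strong induction supplies the vanishing of all lower derivatives; excluding both
    signs leaves only 0.\<close>
  have zero: "?\<Gamma> \<turnstile> Eq (?P i) 0" for i
  proof (induction i rule: less_induct)
    case (less i)
    have "?\<Gamma> \<turnstile> Neg (Gt (?P i) 0)"
      by (rule not_pos[where u = ?P]) (use indets hyp less in auto)
    moreover have "?\<Gamma> \<turnstile> Neg (Gt (- ?P i) 0)"
    proof (rule not_pos[where u = "\<lambda>k. - ?P k"])
      show "?\<Gamma> \<turnstile> Box (ODE ?odet Q) (Eq (- ?P 0) 0)"
        by (rule derive_box_arith[where \<Delta> = "[Eq p 0]"]) (use hyp wf dist Q in auto)
      show "?\<Gamma> \<turnstile> Eq (- ?P k) 0" if "k < i" for k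
        by (rule derive_arith[where \<Delta> = "[Eq (?P k) 0]"]) (use less that wf in auto)
    qed (use indets in auto)
    ultimately show ?case
      by (intro derive_arith[where \<Delta> = "[Neg (Gt (?P i) 0), Neg (Gt (- ?P i) 0)]"])
         (use wf in auto)
  qed
  let ?C = "Conj (map (\<lambda>i. Eq (?P i) 0) [0..<N])"
  have C: "?\<Gamma> \<turnstile> ?C"
    by (rule derive_arith[where \<Delta> = "map (\<lambda>i. Eq (?P i) 0) [0..<N]"]) (use zero wf in auto)
  let ?\<Gamma>\<^sub>0 = "[Q, Box (ODE ?ode Q) (Eq p 0)]"
  have wf0: "wfs ?\<Gamma>\<^sub>0"
    using wf dist Q by auto
  \<comment> \<open>A zero matrix and the constant 1 make (DG) add the clock \<open>t' = 1\<close>.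
    Its initial value is arbitrary, which is why progress is measured from the copy
    \<open>t0\<close>.\<close>
  have ghosts: "ghosts [t] (\<lambda>_ _. 0) (\<lambda>_. 1) = [(t, 1)]"
    by (simp add: ghosts_def)
  have "?\<Gamma>\<^sub>0 \<turnstile> Iff (Box (ODE ?ode Q) (Eq p 0))
      (foldr Exists [t] (Box (ODE (?ode @ ghosts [t] (\<lambda>_ _. 0) (\<lambda>_. 1)) Q) (Eq p 0)))"
  proof (intro derive_axiom0 axiom0.DG)
    show "set [t] \<inter> (ode_vars ?ode \<union> vars Q \<union> vars (Eq p 0)) = {}"
      using ode_vars fresh(2) p by auto
  qed (use wf0 dist Q in \<open>auto simp: ghosts\<close>)
  from derive_IffD1[OF this] have "?\<Gamma>\<^sub>0 \<turnstile> foldr Exists [t] (Box (ODE ?odet Q) (Eq p 0))"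
    unfolding ghosts using wf0 dist Q derive_assumption[of _ ?\<Gamma>\<^sub>0] by auto
  moreover have "foldr Exists [t] (Box (ODE ?odet Q) (Eq p 0)) # ?\<Gamma>\<^sub>0 \<turnstile> ?C"
  proof (rule derive_ExistsE)
    show "Box (ODE ?odet Q) (Eq p 0) # ?\<Gamma>\<^sub>0 \<turnstile> ?C"
      by (rule derivable.Weaken[OF C]) (use wf wf0 in auto)
    have "\<Union> (FV ` set ?\<Gamma>\<^sub>0) \<union> FV ?C \<subseteq> set xs"
      using ode_vars p Q(2) by (auto dest: subsetD[OF indets])
    then show "set [t] \<inter> (\<Union> (FV ` set ?\<Gamma>\<^sub>0) \<union> FV ?C) = {}"
      using fresh(2) by auto
  qed
  ultimately show ?thesis
    by (rule derivable.Cut)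
qed

theorem theorem5:
  fixes xs :: "nat list" and fs :: "trm list" and p :: trm and Q :: fml and N :: nat
  assumes "distinct xs" and "length fs = length xs"
    and "\<forall>e\<in>set fs. indets e \<subseteq> set xs"
    and "indets p \<subseteq> set xs"
    and "has_rank (zip xs fs) p N"
    and "fo Q" and "FV Q \<subseteq> set xs"
    and "openin (powertop_real (set xs)) {\<nu> \<in> extensional (set xs). sat Q \<nu>}"
  shows "derivable_C1
    (Iff (Box (ODE (zip xs fs) Q) (Eq p 0))
         (Imp Q (Conj (map (\<lambda>i. Eq ((lie (zip xs fs) ^^ i) p) 0) [0..<N]))))"
proof (rule derivable.IffR)
  show "[Box (ODE (zip xs fs) Q) (Eq p 0)] \<turnstile>
      Imp Q (Conj (map (\<lambda>i. Eq ((lie (zip xs fs) ^^ i) p) 0) [0..<N]))"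
    using assms by (intro derivable.ImpR derive_necessity)
  show "[Imp Q (Conj (map (\<lambda>i. Eq ((lie (zip xs fs) ^^ i) p) 0) [0..<N]))] \<turnstile>
      Box (ODE (zip xs fs) Q) (Eq p 0)"
    using assms by (intro derive_sufficiency) (auto simp: has_rank_def)
qed

end
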